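(* Let $n\ge 3$, let $\eta\in\mathbb C$ be a constant with $\eta\notin\mathbb Z+\tau\mathbb Z$, and let $$\phi(\zeta)=\sum_{i=1}^n\alpha_i\psi_i(\zeta),\qquad \phi_1(\zeta)=\sum_{i=1}^n\beta_i\psi_i(\zeta),\qquad \phi_2(\zeta)=\sum_{i=1}^n\gamma_i\psi_i(\zeta)$$ be linearly independent, where $\alpha_i,\beta_i,\gamma_i$ are constants and $$\psi_i(\zeta)=\theta(\zeta-u_i+\eta)\prod_{m\neq i}\theta(\zeta-u_m),\qquad i=1,\dots,n.$$ Let $F,G,H$ be functions of $(\zeta,u_1,\dots,u_n)$ satisfying, with $(K,\chi)=(F,\phi),(G,\phi_1),(H,\phi_2)$ respectively, $$K_\zeta=\frac{\chi(\zeta)}{\theta(\zeta-u_1)\cdots\theta(\zeta-u_n)},\qquad K_{u_i}=-\frac{1}{\prod_{m\ne i}\theta(u_i-u_m)}\cdot\frac{\theta(\zeta-u_i+\eta)}{\theta(\eta)\theta(\zeta-u_i)}\cdot\chi(u_i),\quad i=1,\dots,n.$$ Then the system for $\mathbf u=(u_1,\dots,u_n)$ with pseudopotential $\Psi_y=F$, $\Psi_t=G$, $\Psi_x=H$ can be written in the form: for each $j=1,\dots,n$, $$\sum_{\substack{1\le i\le n\\ i\ne j}}\frac{\theta(u_j-u_i+\eta)}{\theta(u_j-u_i)}\Big((\gamma_i\alpha_j-\gamma_j\alpha_i)(u_{it}-u_{jt})+(\alpha_i\beta_j-\alpha_j\beta_i)(u_{ix}-u_{jx})+(\beta_i\ga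mma_j-\beta_j\gamma_i)(u_{iy}-u_{jy})\Big)=0.$$
   Context: Everything is local and analytic, on a domain where $u_1,\dots,u_n$ are pairwise distinct modulo $\mathbb Z+\tau\mathbb Z$ and $\zeta\ne u_i$ modulo $\mathbb Z+\tau\mathbb Z$. Fix $\tau\in\mathbb C$ with $\operatorname{Im}\tau>0$ and put $$\theta(z)=\sum_{m\in\mathbb Z}(-1)^m e^{2\pi i\left(mz+\frac{m(m-1)}{2}\tau\right)},$$ an entire function with $\theta(z+1)=\theta(z)$, $\theta(z+\tau)=-e^{-2\pi i z}\theta(z)$, whose only zero modulo $1$ and $\tau$ is $z=0$. Whenever $\chi(\zeta)=\sum_{i=1}^n c_i\,\theta(\zeta-u_i+\eta)\prod_{m\ne i}\theta(\zeta-u_m)$ with constants $c_1,\dots,c_n$, the equations $$K_\zeta=\frac{\chi(\zeta)}{\theta(\zeta-u_1)\cdots\theta(\zeta-u_n)},\qquad K_{u_i}=-\frac{1}{\prod_{m\ne i}\theta(u_i-u_m)}\cdot\frac{\theta(\zeta-u_i+\eta)}{\theta(\eta)\theta(\zeta-u_i)}\cdot\chi(u_i),\quad i=1,\dots,n,$$ for an unknown function $K(\zeta,u_1,\dots,u_n)$ are in involution; in particular the equations defining each of $F,G,H$ (with $\chi=\phi,\phi_1,\phi_2$, that is $c_i=\alpha_i,\beta_i,\gamma_i$, respectively) are in involution. Compatibility conditions. For a system $\Psi_y=F(\zeta,\mathbf u)$, $\Psi_t=G(\zeta,\mathbf u)$, $\Psi_x=H(\zeta,\mathbf u)$, where $\zeta$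 is a parameter to be eliminated (expressed through $\Psi_y$ from the first equation) and $\mathbf u=\mathbf u(x,y,t)$, the compatibility condition is $$\sum_{i=1}^n(H_{\zeta}G_{u_i}-G_{\zeta}H_{u_i})u_{iy}+\sum_{i=1}^n(F_{\zeta}H_{u_i}-H_{\zeta}F_{u_i})u_{it}+\sum_{i=1}^n(G_{\zeta}F_{u_i}-F_{\zeta}G_{u_i})u_{ix}=0,$$ required to hold identically in $\zeta$. The system for $\mathbf u$ with this pseudopotential is the quasilinear system equivalent to this compatibility condition.
   Formalization: For every η outside ℤ+τℤ only "compatibility implies the displayed system" is claimed; the equivalence is stated under the extra condition 2η∉ℤ+τℤ, since the converse fails when 2η lies in the lattice (e.g. n=3 with α,β,γ the unit vectors). *)

theory Defs
  imports "HOL-Analysis.Analysis"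
begin

definition lattice :: "complex \<Rightarrow> complex set" where
  "lattice \<tau> = {of_int k + of_int l * \<tau> | k l. True}"

definition theta :: "complex \<Rightarrow> complex \<Rightarrow> complex" where
  "theta \<tau> z = (\<Sum>\<^sub>\<infinity>m\<in>(UNIV :: int set). (-1) powi m *
     exp (2 * of_real pi * \<i> * (of_int m * z + of_int (m * (m - 1)) / 2 * \<tau>)))"

definition psi :: "complex \<Rightarrow> complex \<Rightarrow> complex ^ 'n::finite \<Rightarrow> 'n \<Rightarrow> complex \<Rightarrow> complex" where
  "psi \<tau> \<eta> u i \<zeta> = theta \<tau> (\<zeta> - u $ i + \<eta>) * (\<Prod>m\<in>UNIV - {i}. theta \<tau> (\<zeta> - u $ m))"

definition chi_comb ::
  "complex \<Rightarrow> complex \<Rightarrow> complex ^ 'n::finite \<Rightarrow> complex ^ 'n \<Rightarrow> complex \<Rightarrow> complex" where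
  "chi_comb \<tau> \<eta> c u \<zeta> = (\<Sum>i\<in>UNIV. c $ i * psi \<tau> \<eta> u i \<zeta>)"

definition lin_indep3 ::
  "(complex \<Rightarrow> complex) \<Rightarrow> (complex \<Rightarrow> complex) \<Rightarrow> (complex \<Rightarrow> complex) \<Rightarrow> bool" where
  "lin_indep3 f g h \<longleftrightarrow>
     (\<forall>a b c. (\<forall>\<zeta>. a * f \<zeta> + b * g \<zeta> + c * h \<zeta> = 0) \<longrightarrow> a = 0 \<and> b = 0 \<and> c = 0)"

definition generic_points :: "complex \<Rightarrow> (complex \<times> (complex ^ 'n::finite)) set" where
  "generic_points \<tau> = {(\<zeta>, u). (\<forall>i j. i \<noteq> j \<longrightarrow> u $ i - u $ j \<notin> lattice \<tau>) \<and>
                                (\<forall>i. \<zeta> - u $ i \<notin> lattice \<tau>)}"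

definition upd :: "'a ^ 'n::finite \<Rightarrow> 'n \<Rightarrow> 'a \<Rightarrow> 'a ^ 'n" where
  "upd u i w = (\<chi> m. if m = i then w else u $ m)"

text \<open>A function with these partial derivatives on the open set \<open>D\<close> is separately
  holomorphic, hence analytic by Hartogs, so analyticity of \<open>K\<close> is not a separate requirement.\<close>

definition satisfies_K_equations ::
  "complex \<Rightarrow> complex \<Rightarrow> complex ^ 'n::finite \<Rightarrow> (complex \<times> (complex ^ 'n)) set \<Rightarrow>
   (complex \<Rightarrow> complex ^ 'n \<Rightarrow> complex) \<Rightarrow> bool" where
  "satisfies_K_equations \<tau> \<eta> c D K \<longleftrightarrow> (\<forall>(\<zeta>, u) \<in> D.
     ((\<lambda>z. K z u) has_field_derivative
        chi_comb \<tau> \<eta> c u \<zeta> / (\<Prod>m\<in>UNIV. theta \<tau> (\<zeta> - u $ m))) (at \<zeta>) \<and>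
     (\<forall>i. ((\<lambda>w. K \<zeta> (upd u i w)) has_field_derivative
        - (1 / (\<Prod>m\<in>UNIV - {i}. theta \<tau> (u $ i - u $ m)))
          * (theta \<tau> (\<zeta> - u $ i + \<eta>) / (theta \<tau> \<eta> * theta \<tau> (\<zeta> - u $ i)))
          * chi_comb \<tau> \<eta> c u (u $ i)) (at (u $ i))))"

definition holomorphic_map_on ::
  "(complex \<times> complex \<times> complex \<Rightarrow> complex ^ 'n::finite) \<Rightarrow> (complex \<times> complex \<times> complex) set \<Rightarrow> bool" where
  "holomorphic_map_on u W \<longleftrightarrow> (\<forall>p\<in>W. \<exists>L. (u has_derivative L) (at p) \<and>
     (\<forall>c x y t. L (c * x, c * y, c * t) = c *s L (x, y, t)))"

definition d_zeta :: "(complex \<Rightarrow> complex ^ 'n::finite \<Rightarrow> complex) \<Rightarrow> complex \<Rightarrow> complex ^ 'n \<Rightarrow> complex" where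
  "d_zeta K \<zeta> u = deriv (\<lambda>z. K z u) \<zeta>"

definition d_u :: "(complex \<Rightarrow> complex ^ 'n::finite \<Rightarrow> complex) \<Rightarrow> 'n \<Rightarrow> complex \<Rightarrow> complex ^ 'n \<Rightarrow> complex" where
  "d_u K i \<zeta> u = deriv (\<lambda>w. K \<zeta> (upd u i w)) (u $ i)"

text \<open>The independent variables are ordered as \<open>(x, y, t)\<close>.\<close>

definition dx :: "(complex \<times> complex \<times> complex \<Rightarrow> complex ^ 'n::finite) \<Rightarrow> 'n \<Rightarrow> complex \<times> complex \<times> complex \<Rightarrow> complex" where
  "dx u i = (\<lambda>(x, y, t). deriv (\<lambda>s. u (s, y, t) $ i) x)"

definition dy :: "(complex \<times> complex \<times> complex \<Rightarrow> complex ^ 'n::finite) \<Rightarrow> 'n \<Rightarrow> complex \<times> complex \<times> complex \<Rightarrow> complex" where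
  "dy u i = (\<lambda>(x, y, t). deriv (\<lambda>s. u (x, s, t) $ i) y)"

definition dt :: "(complex \<times> complex \<times> complex \<Rightarrow> complex ^ 'n::finite) \<Rightarrow> 'n \<Rightarrow> complex \<times> complex \<times> complex \<Rightarrow> complex" where
  "dt u i = (\<lambda>(x, y, t). deriv (\<lambda>s. u (x, y, s) $ i) t)"

text \<open>The compatibility condition of \<open>\<Psi>\<^sub>y = F\<close>, \<open>\<Psi>\<^sub>t = G\<close>, \<open>\<Psi>\<^sub>x = H\<close> along \<open>u\<close>, identically in \<open>\<zeta>\<close>;
  \<open>D\<close> is the common domain of \<open>F\<close>, \<open>G\<close>, \<open>H\<close>.\<close>

definition compatibility_condition ::
  "(complex \<Rightarrow> complex ^ 'n::finite \<Rightarrow> complex) \<Rightarrow> (complex \<Rightarrow> complex ^ 'n \<Rightarrow> complex) \<Rightarrow>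
   (complex \<Rightarrow> complex ^ 'n \<Rightarrow> complex) \<Rightarrow> (complex \<times> (complex ^ 'n)) set \<Rightarrow>
   (complex \<times> complex \<times> complex) set \<Rightarrow> (complex \<times> complex \<times> complex \<Rightarrow> complex ^ 'n) \<Rightarrow> bool" where
  "compatibility_condition F G H D W u \<longleftrightarrow> (\<forall>p\<in>W. \<forall>\<zeta>. (\<zeta>, u p) \<in> D \<longrightarrow>
     (\<Sum>i\<in>UNIV. (d_zeta H \<zeta> (u p) * d_u G i \<zeta> (u p) - d_zeta G \<zeta> (u p) * d_u H i \<zeta> (u p)) * dy u i p)
   + (\<Sum>i\<in>UNIV. (d_zeta F \<zeta> (u p) * d_u H i \<zeta> (u p) - d_zeta H \<zeta> (u p) * d_u F i \<zeta> (u p)) * dt u i p)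
   + (\<Sum>i\<in>UNIV. (d_zeta G \<zeta> (u p) * d_u F i \<zeta> (u p) - d_zeta F \<zeta> (u p) * d_u G i \<zeta> (u p)) * dx u i p)
   = 0)"

definition elliptic_system ::
  "complex \<Rightarrow> complex \<Rightarrow> complex ^ 'n::finite \<Rightarrow> complex ^ 'n \<Rightarrow> complex ^ 'n \<Rightarrow>
   (complex \<times> complex \<times> complex) set \<Rightarrow> (complex \<times> complex \<times> complex \<Rightarrow> complex ^ 'n) \<Rightarrow> bool" where
  "elliptic_system \<tau> \<eta> \<alpha> \<beta> \<gamma> W u \<longleftrightarrow> (\<forall>p\<in>W. \<forall>j.
     (\<Sum>i\<in>UNIV - {j}. theta \<tau> (u p $ j - u p $ i + \<eta>) / theta \<tau> (u p $ j - u p $ i) *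
        ((\<gamma> $ i * \<alpha> $ j - \<gamma> $ j * \<alpha> $ i) * (dt u i p - dt u j p)
       + (\<alpha> $ i * \<beta> $ j - \<alpha> $ j * \<beta> $ i) * (dx u i p - dx u j p)
       + (\<beta> $ i * \<gamma> $ j - \<beta> $ j * \<gamma> $ i) * (dy u i p - dy u j p))) = 0)"

end

theory Submission
  imports Defs "HOL-Complex_Analysis.Conformal_Mappings"
begin

text \<open>
  Put \<open>f\<^sub>k(\<zeta>) = \<theta>(\<zeta> - u\<^sub>k + \<eta>) / \<theta>(\<zeta> - u\<^sub>k)\<close>. Then \<open>K\<^sub>\<zeta>\<close> is the sum of the \<open>c\<^sub>k f\<^sub>k\<close> and the
  derivative of \<open>K\<close> in \<open>u\<^sub>i\<close> is \<open>- c\<^sub>i f\<^sub>i\<close>, so the compatibility condition is a relation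
  \<open>\<Sum> S\<^sub>i\<^sub>k f\<^sub>i f\<^sub>k = 0\<close> over \<open>i \<noteq> k\<close> with \<open>S\<close> symmetric and independent of \<open>\<zeta>\<close>. Its left-hand side has at
  most simple poles, at the points \<open>u\<^sub>j\<close>, and the residue at \<open>u\<^sub>j\<close> is, up to a nonzero factor,
  \<open>\<Sum> S\<^sub>j\<^sub>k f\<^sub>k(u\<^sub>j)\<close>, the left-hand side of the \<open>j\<close>-th equation of the system. Conversely, if all
  residues vanish then the left-hand side is entire, has period 1 and is multiplied by
  \<open>exp (-4\<pi>\<i>\<eta>)\<close> under \<open>\<zeta> \<mapsto> \<zeta> + \<tau>\<close>; by Liouville's theorem it is a multiple of an exponential, and
  it vanishes unless \<open>2\<eta>\<close> is a lattice point.

  The simplicity and location of the zeros of \<open>\<theta>\<close> come from comparison with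
  \<open>\<Prod>\<^sub>n (1 - q\<^sup>n w)(1 - q\<^sup>n\<^sup>+\<^sup>1 / w)\<close>, where \<open>q = exp (2\<pi>\<i>\<tau>)\<close> and \<open>w = exp (2\<pi>\<i>z)\<close>: the quotient is
  entire and doubly periodic, hence constant.
\<close>

section \<open>Power series with vanishing coefficient ratios\<close>

text \<open>The coefficients are given through their successive quotients \<open>r k\<close>: a
  functional equation becomes an identity between consecutive coefficients, and \<open>r\<close>
  tending to 0 makes the series entire.\<close>

definition ratio_series :: "(nat \<Rightarrow> complex) \<Rightarrow> complex \<Rightarrow> complex" where
  "ratio_series r w = (\<Sum>n. (\<Prod>k<n. r k) * w ^ n)"

text \<open>Consecutive terms have quotient \<open>r n * w\<close>, which tends to 0; the constant
  1/2 stands for any bound strictly between 0 and 1.\<close>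

lemma summable_norm_ratio_series:
  fixes r :: "nat \<Rightarrow> complex"
  assumes "r \<longlonglongrightarrow> 0"
  shows "summable (\<lambda>n. norm ((\<Prod>k<n. r k) * w ^ n))"
proof -
  have "(\<lambda>n. norm (r n * w)) \<longlonglongrightarrow> 0"
    using tendsto_norm_zero[OF tendsto_mult_left_zero[OF assms, of w]] by simp
  then have "\<forall>\<^sub>F n in sequentially. norm (r n * w) < 1/2"
    by (rule order_tendstoD) simp
  then obtain N where N: "\<And>n. n \<ge> N \<Longrightarrow> norm (r n * w) < 1/2"
    by (auto simp: eventually_sequentially)
  show ?thesis
  proof (rule summable_ratio_test[of "1/2" N])
    fix n assume "n \<ge> N"
    have "norm ((\<Prod>k<Suc n. r k) * w ^ Suc n) = norm (r n * w) * norm ((\<Prod>k<n. r k) * w ^ n)"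
      by (simp add: norm_mult mult_ac)
    also have "\<dots> \<le> 1/2 * norm ((\<Prod>k<n. r k) * w ^ n)"
      using N[OF \<open>n \<ge> N\<close>] by (intro mult_right_mono) auto
    finally show "norm (norm ((\<Prod>k<Suc n. r k) * w ^ Suc n))
        \<le> 1/2 * norm (norm ((\<Prod>k<n. r k) * w ^ n))" by simp
  qed simp
qed

lemma summable_ratio_series:
  fixes r :: "nat \<Rightarrow> complex"
  assumes "r \<longlonglongrightarrow> 0"
  shows "summable (\<lambda>n. (\<Prod>k<n. r k) * w ^ n)"
  using summable_norm_cancel[OF summable_norm_ratio_series[OF assms]] .

lemma ratio_series_sums:
  fixes r :: "nat \<Rightarrow> complex"
  assumes "r \<longlonglongrightarrow> 0"
  shows "(\<lambda>n. (\<Prod>k<n. r k) * w ^ n) sums ratio_series r w"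
  unfolding ratio_series_def using summable_sums[OF summable_ratio_series[OF assms]] .

lemma holomorphic_ratio_series:
  fixes r :: "nat \<Rightarrow> complex"
  assumes "r \<longlonglongrightarrow> 0"
  shows "ratio_series r holomorphic_on S"
proof -
  have "ratio_series r field_differentiable at w" for w
    unfolding ratio_series_def field_differentiable_def
    using termdiffs_strong_converges_everywhere[OF summable_ratio_series[OF assms]] by blast
  then show ?thesis
    by (simp add: holomorphic_on_def field_differentiable_at_within)
qed

lemmas holomorphic_ratio_series_compose =
  holomorphic_on_compose_gen[OF _ holomorphic_ratio_series, unfolded o_def, OF _ _ subset_UNIV]

lemma ratio_series_0 [simp]: "ratio_series r 0 = 1"
  unfolding ratio_series_def using powser_zero[of "\<lambda>n. \<Prod>k<n. r k"] by simp

lemma ratio_series_tail_sums: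
  fixes r :: "nat \<Rightarrow> complex"
  assumes "r \<longlonglongrightarrow> 0"
  shows "(\<lambda>n. (\<Prod>k<Suc n. r k) * w ^ Suc n) sums (ratio_series r w - 1)"
  using sums_split_initial_segment[OF ratio_series_sums[OF assms], of 1] by simp

section \<open>The theta function as a combination of power series\<close>

text \<open>In the variable \<open>w = unit_exp z\<close> the period 1 disappears and the shift by
  \<tau> becomes multiplication by \<open>q = unit_exp \<tau>\<close>.\<close>

definition unit_exp :: "complex \<Rightarrow> complex" where
  "unit_exp z = exp (2 * of_real pi * \<i> * z)"

lemma unit_exp_nonzero [simp]: "unit_exp z \<noteq> 0"
  by (simp add: unit_exp_def)

lemma unit_exp_0 [simp]: "unit_exp 0 = 1"
  by (simp add: unit_exp_def)

lemma unit_exp_1 [simp]: "unit_exp 1 = 1"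
  using exp_two_pi_i by (simp add: unit_exp_def mult_ac)

lemma unit_exp_add: "unit_exp (z + w) = unit_exp z * unit_exp w"
  by (simp add: unit_exp_def exp_add ring_distribs)

lemma unit_exp_minus: "unit_exp (- z) = 1 / unit_exp z"
  by (simp add: unit_exp_def exp_minus field_simps)

lemma unit_exp_of_nat_mult: "unit_exp (of_nat n * z) = unit_exp z ^ n"
  by (simp add: unit_exp_def exp_of_nat_mult[symmetric] mult_ac)

lemma unit_exp_of_int_mult: "unit_exp (of_int n * z) = unit_exp z powi n"
  by (simp add: unit_exp_def exp_power_int mult_ac)

lemma norm_unit_exp: "norm (unit_exp z) = exp (- 2 * pi * Im z)"
  by (simp add: unit_exp_def)

lemma unit_exp_eq_1_iff: "unit_exp z = 1 \<longleftrightarrow> z \<in> \<int>"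
proof
  assume "unit_exp z = 1"
  then obtain n :: int where "Re (2 * of_real pi * \<i> * z) = 0"
      "Im (2 * of_real pi * \<i> * z) = of_int (2 * n) * pi"
    by (auto simp: unit_exp_def exp_eq_1)
  then have "z = of_int n" by (simp add: complex_eq_iff)
  then show "z \<in> \<int>" by simp
next
  assume "z \<in> \<int>"
  then obtain n where "z = of_int n" by (elim Ints_cases)
  then show "unit_exp z = 1" using unit_exp_of_int_mult[of n 1] by simp
qed

lemma holomorphic_unit_exp [holomorphic_intros]:
  "f holomorphic_on S \<Longrightarrow> (\<lambda>z. unit_exp (f z)) holomorphic_on S"
  unfolding unit_exp_def by (intro holomorphic_intros)

lemma DERIV_unit_exp: "(unit_exp has_field_derivative 2 * of_real pi * \<i> * unit_exp z) (at z)"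
  unfolding unit_exp_def by (auto intro!: derivative_eq_intros)

text \<open>Written out, the n-th term is \<open>(-1) ^ n * q ^ (n * (n - 1) div 2) * w ^ n\<close>:
  the half of the theta series with nonnegative index.\<close>

definition partial_theta :: "complex \<Rightarrow> complex \<Rightarrow> complex" where
  "partial_theta q = ratio_series (\<lambda>k. - (q ^ k))"

lemma partial_theta_ratio:
  fixes q :: complex
  assumes "norm q < 1"
  shows "(\<lambda>k. - (q ^ k)) \<longlonglongrightarrow> 0"
  using tendsto_minus[OF LIMSEQ_power_zero[OF assms]] by simp

text \<open>The step to the next coefficient multiplies by \<open>- (q ^ n)\<close>, and the power
  of \<open>q\<close> turns \<open>w ^ n\<close> into \<open>(q * w) ^ n\<close>.\<close>

lemma partial_theta_rec:
  assumes "norm q < 1"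
  shows "partial_theta q w = 1 - w * partial_theta q (q * w)"
proof -
  note r = partial_theta_ratio[OF assms]
  have prod: "(\<Prod>k<Suc n. - (q ^ k)) = - (q ^ n) * (\<Prod>k<n. - (q ^ k))" for n
    by simp
  have "(\<lambda>n. - w * ((\<Prod>k<n. - (q ^ k)) * (q * w) ^ n)) sums (- w * partial_theta q (q * w))"
    unfolding partial_theta_def by (intro sums_mult ratio_series_sums r)
  also have "(\<lambda>n. - w * ((\<Prod>k<n. - (q ^ k)) * (q * w) ^ n)) =
      (\<lambda>n. (\<Prod>k<Suc n. - (q ^ k)) * w ^ Suc n)"
    unfolding prod by (simp add: fun_eq_iff power_mult_distrib)
  finally show ?thesis
    using sums_unique2[OF ratio_series_tail_sums[OF r, of w]]
    by (auto simp: partial_theta_def algebra_simps)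
qed

lemma partial_theta_coeff: "(\<Prod>k<n. - (q ^ k)) = (-1) ^ n * (q :: complex) ^ (n * (n - 1) div 2)"
proof (induction n)
  case (Suc n)
  have "Suc n * (Suc n - 1) div 2 = n + n * (n - 1) div 2"
    by (cases n) auto
  then show ?case using Suc by (simp add: power_add)
qed simp

text \<open>The bilateral series is split at index 0. The negative indices give the second series
  without its constant term, whence the \<open>- 1\<close>.\<close>

lemma theta_eq_partial_theta:
  assumes "Im \<tau> > 0"
  shows "theta \<tau> z = partial_theta (unit_exp \<tau>) (unit_exp z)
           + partial_theta (unit_exp \<tau>) (unit_exp \<tau> / unit_exp z) - 1"
proof -
  define q w where "q = unit_exp \<tau>" and "w = unit_exp z"
  have w: "w \<noteq> 0" and "q \<noteq> 0" by (auto simp: w_def q_def)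
  have "norm q < 1" using assms by (simp add: q_def norm_unit_exp)
  note r = partial_theta_ratio[OF this]
  define t where "t m = (-1) powi m *
     exp (2 * of_real pi * \<i> * (of_int m * z + of_int (m * (m - 1)) / 2 * \<tau>))" for m :: int
  have tri: "of_int (int n * (int n - 1)) / 2 = (of_nat (n * (n - 1) div 2) :: complex)" for n
  proof (induction n)
    case (Suc n)
    have "Suc n * (Suc n - 1) div 2 = n + n * (n - 1) div 2"
      by (cases n) auto
    then show ?case using Suc by (simp add: field_simps)
  qed simp
  have pos: "t (int n) = (\<Prod>k<n. - (q ^ k)) * w ^ n" for n
    unfolding t_def tri partial_theta_coeff q_def w_def unit_exp_def[symmetric]
      unit_exp_add unit_exp_of_nat_mult by (simp add: unit_exp_of_nat_mult)
  have neg: "t (- int (Suc n)) = (\<Prod>k<Suc n. - (q ^ k)) * (q / w) ^ Suc n" for n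
  proof -
    let ?N = "int (Suc n)"
    \<comment> \<open>At m = -N the number m(m-1)/2 equals N + N(N-1)/2; the extra N turns the power
      \<open>1 / w ^ N\<close> into \<open>(q / w) ^ N\<close>.\<close>
    have exponent: "of_int (- ?N * (- ?N - 1)) / 2 = (of_nat (Suc n + Suc n * (Suc n - 1) div 2) :: complex)"
      unfolding of_nat_add tri[symmetric] by (simp add: field_simps)
    have "unit_exp (of_int (- ?N) * z) = 1 / w ^ Suc n"
      unfolding unit_exp_of_int_mult w_def by (simp only: power_int_minus power_int_of_nat inverse_eq_divide)
    moreover have "(-1 :: complex) powi (- ?N) = (-1) ^ Suc n"
      by (simp only: power_int_minus_one_minus power_int_of_nat)
    ultimately have "t (- ?N) = (-1) ^ Suc n * (1 / w ^ Suc n * q ^ (Suc n + Suc n * (Suc n - 1) div 2))"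
      unfolding t_def exponent unit_exp_def[symmetric] unit_exp_add unit_exp_of_nat_mult q_def by simp
    then show ?thesis
      unfolding partial_theta_coeff power_divide power_add by (simp only: mult_ac times_divide_eq_right times_divide_eq_left mult_1_left)
  qed
  \<comment> \<open>Summation over the integers is unconditional, so each half has to converge
    absolutely.\<close>
  have "((t \<circ> int) has_sum partial_theta q w) UNIV"
    unfolding partial_theta_def o_def pos
    by (intro norm_summable_imp_has_sum summable_norm_ratio_series ratio_series_sums r)
  then have 1: "(t has_sum partial_theta q w) (range int)"
    by (subst has_sum_reindex) (auto simp: inj_on_def)
  have "((t \<circ> (\<lambda>n. - int (Suc n))) has_sum (partial_theta q (q / w) - 1)) UNIV"
    unfolding partial_theta_def o_def neg
    by (intro norm_summable_imp_has_sum ratio_series_tail_sums r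
        summable_norm_ratio_series[THEN iffD2[OF summable_Suc_iff]])
  then have 2: "(t has_sum (partial_theta q (q / w) - 1)) (range (\<lambda>n. - int (Suc n)))"
    by (subst has_sum_reindex) (auto simp: inj_on_def)
  have un: "range int \<union> range (\<lambda>n. - int (Suc n)) = UNIV"
  proof (intro equalityI subsetI)
    fix m :: int
    show "m \<in> range int \<union> range (\<lambda>n. - int (Suc n))" by (cases m) (auto simp del: of_nat_Suc)
  qed simp
  have "(t has_sum (partial_theta q w + (partial_theta q (q / w) - 1))) UNIV"
    unfolding un[symmetric] by (intro has_sum_Un_disjoint 1 2) auto
  then show ?thesis
    unfolding theta_def t_def q_def w_def by (simp add: infsumI)
qed

lemma holomorphic_theta [holomorphic_intros]:
  assumes "f holomorphic_on S" and "Im \<tau> > 0"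
  shows "(\<lambda>z. theta \<tau> (f z)) holomorphic_on S"
proof -
  have "norm (unit_exp \<tau>) < 1" using assms by (simp add: norm_unit_exp)
  note r = partial_theta_ratio[OF this]
  show ?thesis
    unfolding theta_eq_partial_theta[OF assms(2)] partial_theta_def
    by (intro holomorphic_intros holomorphic_ratio_series_compose[OF _ r] assms) auto
qed

lemma theta_add_1:
  assumes "Im \<tau> > 0"
  shows "theta \<tau> (z + 1) = theta \<tau> z"
  unfolding theta_eq_partial_theta[OF assms] by (simp add: unit_exp_add)

text \<open>The shift replaces \<open>w\<close> by \<open>q * w\<close> in one half and
  \<open>q / w\<close> by \<open>1 / w\<close> in the other; the recursion at \<open>w\<close> and
  at \<open>1 / w\<close> brings both back.\<close>

lemma theta_add_tau:
  assumes "Im \<tau> > 0"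
  shows "theta \<tau> (z + \<tau>) = - unit_exp (- z) * theta \<tau> z"
proof -
  define q w where "q = unit_exp \<tau>" and "w = unit_exp z"
  have [simp]: "w \<noteq> 0" "q \<noteq> 0" by (auto simp: w_def q_def)
  have "norm q < 1" using assms by (simp add: q_def norm_unit_exp)
  note rec = partial_theta_rec[OF this]
  have "w * partial_theta q (w * q) = 1 - partial_theta q w"
    using rec[of w] by (simp add: mult_ac)
  moreover have "w * partial_theta q (1 / w) = w - partial_theta q (q / w)"
    using rec[of "1 / w"] by (simp add: field_simps)
  ultimately have "w * (partial_theta q (w * q) + partial_theta q (q / (w * q)) - 1) =
      - (partial_theta q w + partial_theta q (q / w) - 1)"
    by (simp add: algebra_simps)
  then show ?thesis
    unfolding theta_eq_partial_theta[OF assms]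
    by (simp add: unit_exp_add unit_exp_minus q_def[symmetric] w_def[symmetric] field_simps)
qed

lemma theta_0 [simp]:
  assumes "Im \<tau> > 0"
  shows "theta \<tau> 0 = 0"
proof -
  have "norm (unit_exp \<tau>) < 1" using assms by (simp add: norm_unit_exp)
  from partial_theta_rec[OF this, of 1] show ?thesis
    unfolding theta_eq_partial_theta[OF assms] by simp
qed

text \<open>Otherwise \<open>partial_theta q w = 1 - partial_theta q (q / w)\<close> for nonzero
  \<open>w\<close>. The right side tends to 0 at infinity, so Liouville's theorem makes the entire
  left side vanish, although its value at 0 is 1.\<close>

lemma theta_not_identically_zero:
  assumes "Im \<tau> > 0"
  obtains z where "theta \<tau> z \<noteq> 0"
proof (rule ccontr)
  assume "\<not> thesis"
  then have theta: "theta \<tau> z = 0" for z using that by blast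
  define q where "q = unit_exp \<tau>"
  have "norm q < 1" using assms by (simp add: q_def norm_unit_exp)
  note r = partial_theta_ratio[OF this]
  have eq: "partial_theta q w = 1 - partial_theta q (q / w)" if "w \<noteq> 0" for w
  proof -
    \<comment> \<open>A logarithm turns the identity in \<open>z\<close> into one valid for every
      nonzero \<open>w\<close>.\<close>
    have "w = unit_exp (Ln w / (2 * of_real pi * \<i>))"
      using that by (simp add: unit_exp_def)
    then show ?thesis
      using theta[of "Ln w / (2 * of_real pi * \<i>)"]
      unfolding theta_eq_partial_theta[OF assms] q_def[symmetric] by (simp add: algebra_simps)
  qed
  have hol: "partial_theta q holomorphic_on UNIV"
    unfolding partial_theta_def by (rule holomorphic_ratio_series[OF r])
  then have "isCont (partial_theta q) 0"
    by (metis continuous_on_eq_continuous_at holomorphic_on_imp_continuous_on iso_tuple_UNIV_I open_UNIV)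
  moreover have "((\<lambda>w. q / w) \<longlongrightarrow> 0) at_infinity"
    by (rule tendsto_divide_0[OF tendsto_const]) (simp add: filterlim_ident)
  ultimately have "((\<lambda>w. partial_theta q (q / w)) \<longlongrightarrow> partial_theta q 0) at_infinity"
    by (rule isCont_tendsto_compose)
  then have "((\<lambda>w. 1 - partial_theta q (q / w)) \<longlongrightarrow> 1 - partial_theta q 0) at_infinity"
    by (intro tendsto_intros)
  then have lim: "((\<lambda>w. 1 - partial_theta q (q / w)) \<longlongrightarrow> 0) at_infinity"
    by (simp add: partial_theta_def)
  have "\<forall>\<^sub>F w in at_infinity. 1 - partial_theta q (q / w) = partial_theta q w"
    by (rule eventually_mono[OF eventually_not_equal_at_infinity[of 0]]) (simp add: eq)
  then have "(partial_theta q \<longlongrightarrow> 0) at_infinity"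
    using Lim_transform_eventually[OF lim] by blast
  from Liouville_weak[OF hol this, of 0] show False
    by (simp add: partial_theta_def)
qed

section \<open>Entire functions with multiplicative quasi-periods\<close>

lemma periodic_of_int_mult:
  fixes Q :: "complex \<Rightarrow> 'a"
  assumes "\<And>z. Q (z + p) = Q z"
  shows "Q (z + of_int k * p) = Q z"
proof (induction k arbitrary: z rule: int_induct[of _ 0])
  case (step1 i)
  show ?case using step1(2)[of "z + p"] assms[of z] by (simp add: algebra_simps)
next
  case (step2 i)
  show ?case using step2(2)[of "z - p"] assms[of "z - p"] by (simp add: algebra_simps)
qed simp

text \<open>The value type is arbitrary because the lemma is applied to norms and to truth values
  such as vanishing at a point, which stay invariant when the function itself only picks up a
  factor.\<close>

lemma periodic_lattice:
  fixes Q :: "complex \<Rightarrow> 'a"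
  assumes "\<And>z. Q (z + 1) = Q z" and "\<And>z. Q (z + \<tau>) = Q z" and "l \<in> lattice \<tau>"
  shows "Q (z + l) = Q z"
proof -
  from assms(3) obtain i j where "l = of_int i + of_int j * \<tau>"
    by (auto simp: lattice_def)
  then have "Q (z + l) = Q ((z + of_int i * 1) + of_int j * \<tau>)"
    by (simp add: add.assoc)
  also have "\<dots> = Q z"
    using periodic_of_int_mult[of Q, OF assms(2)] periodic_of_int_mult[of Q, OF assms(1)] by metis
  finally show ?thesis .
qed

lemma lattice_0 [simp]: "0 \<in> lattice \<tau>"
  unfolding lattice_def by (rule CollectI, rule exI[of _ 0], rule exI[of _ 0]) simp

text \<open>A multiple of \<tau> adjusts the imaginary part first, then an integer adjusts the real
  part. The rectangle replaces the period parallelogram because it is a compact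
  \<open>cbox\<close>.\<close>

lemma lattice_translate_into_strip:
  assumes "Im \<tau> > 0"
  obtains l where "l \<in> lattice \<tau>" and "z + l \<in> cbox 0 (Complex 1 (Im \<tau>))"
proof -
  define j where "j = \<lfloor>Im z / Im \<tau>\<rfloor>"
  define i where "i = \<lfloor>Re z - of_int j * Re \<tau>\<rfloor>"
  define l where "l = (of_int (- i) + of_int (- j) * \<tau> :: complex)"
  have "l \<in> lattice \<tau>" unfolding lattice_def l_def by blast
  moreover have "of_int j \<le> Im z / Im \<tau>" "Im z / Im \<tau> \<le> of_int j + 1"
    unfolding j_def by linarith+
  then have "of_int j * Im \<tau> \<le> Im z" "Im z \<le> of_int j * Im \<tau> + Im \<tau>"
    using assms by (auto simp: field_simps)
  moreover have "of_int i \<le> Re z - of_int j * Re \<tau>" "Re z - of_int j * Re \<tau> \<le> of_int i + 1"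
    unfolding i_def by linarith+
  ultimately show thesis
    using that[of l] by (auto simp: l_def in_cbox_complex_iff)
qed

text \<open>A suitable exponential factor makes the modulus of \<open>g\<close> invariant under both
  periods. The product is then bounded by its values on a compact rectangle, hence constant by
  Liouville's theorem.\<close>

lemma quasi_periodic_entire_exponential:
  assumes "Im \<tau> > 0" and hol: "g holomorphic_on UNIV"
    and g1: "\<And>z. g (z + 1) = g z" and g\<tau>: "\<And>z. g (z + \<tau>) = q * g z" and "q \<noteq> 0"
  shows "\<exists>c a. (\<forall>z. g z = c * unit_exp (- (of_real a * z))) \<and> (norm q = 1 \<longrightarrow> a = 0)"
proof -
  \<comment> \<open>Since \<open>a\<close> is real, \<open>unit_exp (of_real a)\<close> has modulus
    1 and the period 1 is kept; the value solves
    \<open>exp (- 2 * pi * a * Im \<tau>) = 1 / norm q\<close>.\<close>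
  define a where "a = ln (norm q) / (2 * pi * Im \<tau>)"
  define h where "h z = g z * unit_exp (of_real a * z)" for z
  have ho: "h holomorphic_on UNIV"
    unfolding h_def by (intro holomorphic_intros hol)
  have h1: "norm (h (z + 1)) = norm (h z)" for z
    by (simp add: h_def g1 norm_mult norm_unit_exp)
  have "norm (unit_exp (of_real a * \<tau>)) = exp (- ln (norm q))"
    using assms(1) by (simp add: norm_unit_exp a_def)
  also have "\<dots> = 1 / norm q"
    using \<open>q \<noteq> 0\<close> by (simp add: exp_minus field_simps)
  finally have "norm (unit_exp (of_real a * \<tau>)) = 1 / norm q" .
  then have h\<tau>: "norm (h (z + \<tau>)) = norm (h z)" for z
    using \<open>q \<noteq> 0\<close> by (simp add: h_def g\<tau> norm_mult unit_exp_add distrib_left)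
  have "compact (h ` cbox 0 (Complex 1 (Im \<tau>)))"
    by (intro compact_continuous_image compact_cbox holomorphic_on_imp_continuous_on
        holomorphic_on_subset[OF ho]) auto
  then have "bounded (h ` cbox 0 (Complex 1 (Im \<tau>)))" by (rule compact_imp_bounded)
  then obtain B where B: "\<And>z. z \<in> cbox 0 (Complex 1 (Im \<tau>)) \<Longrightarrow> norm (h z) \<le> B"
    unfolding bounded_iff by auto
  have "norm (h z) \<le> B" for z
  proof -
    obtain l where l: "l \<in> lattice \<tau>" "z + l \<in> cbox 0 (Complex 1 (Im \<tau>))"
      using lattice_translate_into_strip[OF assms(1)] .
    show ?thesis
      using B[OF l(2)] periodic_lattice[of "\<lambda>z. norm (h z)", OF h1 h\<tau> l(1)] by simp
  qed
  then have "bounded (range h)" unfolding bounded_iff by blast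
  then have "h constant_on UNIV" using Liouville_theorem[OF ho] by blast
  then obtain c where c: "\<And>z. h z = c" unfolding constant_on_def by blast
  have "g z = c * unit_exp (- (of_real a * z))" for z
    using c[of z] unit_exp_nonzero[of "of_real a * z"] by (simp add: h_def unit_exp_minus field_simps)
  moreover have "norm q = 1 \<Longrightarrow> a = 0" by (simp add: a_def)
  ultimately show ?thesis by blast
qed

section \<open>Quotients of entire functions with a simple-zero denominator\<close>

lemma open_nonzero_set:
  fixes P :: "complex \<Rightarrow> complex"
  assumes "P holomorphic_on UNIV"
  shows "open {z. P z \<noteq> 0}"
  using open_Collect_neq[OF holomorphic_on_imp_continuous_on[OF assms] continuous_on_const] .

text \<open>\<open>f\<close> vanishes on the nonempty open set where \<open>P\<close> does not,
  hence everywhere by the identity theorem.\<close>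

lemma entire_eq_0_if_mult_eq_0:
  assumes "f holomorphic_on UNIV" and "P holomorphic_on UNIV"
    and "P a \<noteq> 0" and "\<And>z. f z * P z = (0 :: complex)"
  shows "f z = 0"
proof -
  let ?S = "{z. P z \<noteq> 0}"
  have "open ?S" using assms(2) by (rule open_nonzero_set)
  moreover have "a \<in> ?S" using assms by simp
  ultimately show ?thesis
    using analytic_continuation_open[of ?S UNIV f "\<lambda>_. 0" z] assms(1,4) by force
qed

text \<open>At a zero of \<open>P\<close> the quotient of the derivatives is the limit of
  \<open>N / P\<close>, as the ratio of the two difference quotients shows. The filled-in function
  is continuous there, so the singularity is removable.\<close>

lemma entire_quotient:
  assumes N: "N holomorphic_on UNIV" and P: "P holomorphic_on UNIV"
    and simple: "\<And>z. P z = 0 \<Longrightarrow> N z = 0 \<and> deriv P z \<noteq> (0 :: complex)"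
  obtains g where "g holomorphic_on UNIV" and "\<And>z. N z = g z * P z"
proof -
  define g where "g z = (if P z = 0 then deriv N z / deriv P z else N z / P z)" for z
  note contP = open_nonzero_set[OF P]
  have off: "g holomorphic_on {z. P z \<noteq> 0}"
  proof -
    have "(\<lambda>z. N z / P z) holomorphic_on {z. P z \<noteq> 0}"
      by (intro holomorphic_intros holomorphic_on_subset[OF N] holomorphic_on_subset[OF P]) auto
    then show ?thesis by (rule holomorphic_transform) (simp add: g_def)
  qed
  have "g field_differentiable at z" for z
  proof (cases "P z = 0")
    case False
    then show ?thesis
      using off contP holomorphic_on_imp_differentiable_at by blast
  next
    case True
    have dN: "((\<lambda>w. (N w - N z) / (w - z)) \<longlongrightarrow> deriv N z) (at z)"
      and dP: "((\<lambda>w. (P w - P z) / (w - z)) \<longlongrightarrow> deriv P z) (at z)"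
      using holomorphic_derivI[OF N open_UNIV] holomorphic_derivI[OF P open_UNIV]
      by (auto simp: has_field_derivative_iff)
    \<comment> \<open>The nonzero derivative isolates the zero.\<close>
    have nz: "\<forall>\<^sub>F w in at z. P w \<noteq> 0"
      using tendsto_imp_eventually_ne[OF dP, of 0] simple[OF True]
      by (auto simp: True elim: eventually_mono)
    then obtain r where "r > 0" and r: "\<And>w. w \<in> ball z r \<Longrightarrow> w \<noteq> z \<Longrightarrow> P w \<noteq> 0"
      unfolding eventually_at by (auto simp: dist_commute)
    have "((\<lambda>w. ((N w - N z) / (w - z)) / ((P w - P z) / (w - z))) \<longlongrightarrow> g z) (at z)"
      using tendsto_divide[OF dN dP] simple[OF True] True by (simp add: g_def)
    moreover have "\<forall>\<^sub>F w in at z. ((N w - N z) / (w - z)) / ((P w - P z) / (w - z)) = g w"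
      using nz eventually_neq_at_within[of z z UNIV]
      by eventually_elim (use True simple in \<open>auto simp: g_def\<close>)
    ultimately have lim: "(g \<longlongrightarrow> g z) (at z)"
      using Lim_transform_eventually by blast
    have "g holomorphic_on ball z r"
    proof (rule no_isolated_singularity'[where K = "{z}"])
      show "(g \<longlongrightarrow> g w) (at w within ball z r)" if "w \<in> {z}" for w
        using that lim tendsto_within_subset by blast
      show "g holomorphic_on ball z r - {z}"
        by (rule holomorphic_on_subset[OF off]) (use r in auto)
    qed auto
    then show ?thesis
      using \<open>r > 0\<close> holomorphic_on_imp_differentiable_at[of g "ball z r" z] by simp
  qed
  then have "g holomorphic_on UNIV"
    by (simp add: holomorphic_on_def)
  moreover have "N z = g z * P z" for z
    using simple by (auto simp: g_def)
  ultimately show thesis using that by blast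
qed

text \<open>The common factor \<open>m\<close> cancels in the quotient, leaving the constant
  multiplier \<open>q\<close>. The last clause records that a nonzero exponential must itself have
  period 1 and multiplier \<open>q\<close>; it later excludes a nonzero \<open>c\<close>.\<close>

lemma entire_quotient_quasi_periodic:
  assumes N: "N holomorphic_on UNIV" and P: "P holomorphic_on UNIV" and "P a \<noteq> 0"
    and simple: "\<And>z. P z = 0 \<Longrightarrow> N z = 0 \<and> deriv P z \<noteq> (0 :: complex)"
    and "Im \<tau> > 0" and "q \<noteq> 0"
    and "\<And>z. N (z + 1) = N z" and "\<And>z. P (z + 1) = P z"
    and "\<And>z. N (z + \<tau>) = q * m z * N z" and "\<And>z. P (z + \<tau>) = m z * P z"
    and "\<And>z. m z \<noteq> 0"
  shows "\<exists>c a. (\<forall>z. N z = c * unit_exp (- (of_real a * z)) * P z) \<and> (norm q = 1 \<longrightarrow> a = 0) \<and>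
      (c \<noteq> 0 \<longrightarrow> unit_exp (of_real a) = 1 \<and> q * unit_exp (of_real a * \<tau>) = 1)"
proof -
  obtain g where g: "g holomorphic_on UNIV" and NgP: "\<And>z. N z = g z * P z"
    using entire_quotient[OF N P simple] by blast
  have shift: "(\<lambda>z. g (z + p)) holomorphic_on UNIV" for p
    using holomorphic_on_compose_gen[OF _ g subset_UNIV, of "\<lambda>z. z + p" UNIV]
    by (simp add: o_def holomorphic_on_add holomorphic_on_ident holomorphic_on_const)
  \<comment> \<open>Both shift laws for \<open>g\<close> are first known only after multiplication
    by \<open>P\<close>, which the identity theorem cancels.\<close>
  have "g (z + 1) - g z = 0" for z
  proof (rule entire_eq_0_if_mult_eq_0[where f = "\<lambda>z. g (z + 1) - g z", OF _ P \<open>P a \<noteq> 0\<close>])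
    show "(g (z + 1) - g z) * P z = 0" for z
      using NgP[of z] NgP[of "z + 1"] unfolding assms(7,8) left_diff_distrib by simp
  qed (rule holomorphic_on_diff[OF shift g])
  then have g1: "g (z + 1) = g z" for z by simp
  have "g (z + \<tau>) - q * g z = 0" for z
  proof (rule entire_eq_0_if_mult_eq_0[where f = "\<lambda>z. g (z + \<tau>) - q * g z", OF _ P \<open>P a \<noteq> 0\<close>])
    fix z
    have "m z * ((g (z + \<tau>) - q * g z) * P z) = g (z + \<tau>) * (m z * P z) - q * m z * (g z * P z)"
      by (simp add: algebra_simps)
    also have "\<dots> = 0"
      unfolding NgP[symmetric] assms(10)[symmetric] assms(9) by simp
    finally have "m z * ((g (z + \<tau>) - q * g z) * P z) = 0" .
    then show "(g (z + \<tau>) - q * g z) * P z = 0"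
      using assms(11)[of z] by simp
  qed (rule holomorphic_on_diff[OF shift holomorphic_on_mult[OF holomorphic_on_const g]])
  then have g\<tau>: "g (z + \<tau>) = q * g z" for z by simp
  from quasi_periodic_entire_exponential[OF \<open>Im \<tau> > 0\<close> g g1 g\<tau> \<open>q \<noteq> 0\<close>]
  obtain c a where c: "\<And>z. g z = c * unit_exp (- (of_real a * z))" and a: "norm q = 1 \<Longrightarrow> a = 0"
    by blast
  have "unit_exp (of_real a) = 1 \<and> q * unit_exp (of_real a * \<tau>) = 1" if "c \<noteq> 0"
    using g1[of 0] g\<tau>[of 0] that by (simp add: c unit_exp_minus field_simps)
  then show ?thesis
    using a NgP by (intro exI[of _ c] exI[of _ a]) (simp add: c)
qed

section \<open>Zeros of the theta function\<close>

text \<open>Euler's expansion of the infinite product of the factors \<open>1 - q\<^sup>k w\<close>. Only its functional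
  equation under \<open>w \<mapsto> q w\<close> is needed.\<close>

definition euler_series :: "complex \<Rightarrow> complex \<Rightarrow> complex" where
  "euler_series q = ratio_series (\<lambda>k. - (q ^ k / (1 - q ^ Suc k)))"

lemma euler_series_ratio:
  fixes q :: complex
  assumes "norm q < 1"
  shows "(\<lambda>k. - (q ^ k / (1 - q ^ Suc k))) \<longlonglongrightarrow> 0"
proof -
  have "(\<lambda>k. - (q ^ k / (1 - q * q ^ k))) \<longlonglongrightarrow> - (0 / (1 - q * 0))"
    by (intro tendsto_intros LIMSEQ_power_zero assms) auto
  then show ?thesis by simp
qed

text \<open>In the difference of the values at \<open>w\<close> and \<open>q * w\<close> the
  coefficient of index \<open>Suc n\<close> gains the factor \<open>1 - q ^ Suc n\<close>, which
  cancels the denominator of its last quotient.\<close>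

lemma euler_series_rec:
  assumes "norm q < 1"
  shows "euler_series q w = (1 - w) * euler_series q (q * w)"
proof -
  note r = euler_series_ratio[OF assms]
  let ?a = "\<lambda>n. \<Prod>k<n. - (q ^ k / (1 - q ^ Suc k))"
  have rec: "?a (Suc n) * (1 - q ^ Suc n) = - (q ^ n * ?a n)" for n
  proof -
    have "norm (q ^ Suc n) < 1"
      using assms mult_left_le[of "norm q ^ n" "norm q"] power_le_one[of "norm q" n]
      by (simp add: norm_mult norm_power)
    then have "1 - q ^ Suc n \<noteq> 0" by auto
    then show ?thesis by (simp add: field_simps del: power_Suc)
  qed
  have "(\<lambda>n. ?a (Suc n) * w ^ Suc n - ?a (Suc n) * (q * w) ^ Suc n)
      sums ((euler_series q w - 1) - (euler_series q (q * w) - 1))"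
    unfolding euler_series_def by (intro sums_diff ratio_series_tail_sums[OF r])
  also have "(\<lambda>n. ?a (Suc n) * w ^ Suc n - ?a (Suc n) * (q * w) ^ Suc n) =
      (\<lambda>n. - w * (?a n * (q * w) ^ n))"
  proof
    fix n
    have "?a (Suc n) * w ^ Suc n - ?a (Suc n) * (q * w) ^ Suc n =
        (?a (Suc n) * (1 - q ^ Suc n)) * w ^ Suc n"
      unfolding power_mult_distrib by (simp only: ring_distribs mult_ac mult_1_left mult_1_right)
    also have "\<dots> = - w * (?a n * (q * w) ^ n)"
      unfolding rec power_mult_distrib by (simp add: mult_ac)
    finally show "?a (Suc n) * w ^ Suc n - ?a (Suc n) * (q * w) ^ Suc n
      = - w * (?a n * (q * w) ^ n)" .
  qed
  finally have "(\<lambda>n. - w * (?a n * (q * w) ^ n))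
      sums ((euler_series q w - 1) - (euler_series q (q * w) - 1))" .
  moreover have "(\<lambda>n. - w * (?a n * (q * w) ^ n)) sums (- w * euler_series q (q * w))"
    unfolding euler_series_def by (intro sums_mult ratio_series_sums[OF r])
  ultimately have "(euler_series q w - 1) - (euler_series q (q * w) - 1) = - w * euler_series q (q * w)"
    by (rule sums_unique2)
  then show ?thesis by (simp add: algebra_simps)
qed

lemma euler_series_iterate:
  assumes "norm q < 1"
  shows "euler_series q w = (\<Prod>k<n. 1 - q ^ k * w) * euler_series q (q ^ n * w)"
proof (induction n)
  case (Suc n)
  then show ?case
    using euler_series_rec[OF assms, of "q ^ n * w"] by (simp add: mult_ac)
qed simp

text \<open>\<open>q ^ n * w\<close> tends to 0, where the series has value 1, so after finitely
  many steps the remaining factor is nonzero and one of the factors \<open>1 - q ^ k * w\<close>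
  split off must vanish.\<close>

lemma euler_series_zero:
  assumes "norm q < 1" and "euler_series q w = 0"
  obtains n where "q ^ n * w = 1"
proof -
  have "euler_series q holomorphic_on UNIV"
    unfolding euler_series_def by (rule holomorphic_ratio_series[OF euler_series_ratio[OF assms(1)]])
  then have "isCont (euler_series q) 0"
    by (metis continuous_on_eq_continuous_at holomorphic_on_imp_continuous_on iso_tuple_UNIV_I open_UNIV)
  moreover have "(\<lambda>n. q ^ n * w) \<longlonglongrightarrow> 0"
    by (intro tendsto_mult_left_zero LIMSEQ_power_zero assms(1))
  ultimately have "(\<lambda>n. euler_series q (q ^ n * w)) \<longlonglongrightarrow> euler_series q 0"
    by (rule isCont_tendsto_compose)
  then have "(\<lambda>n. euler_series q (q ^ n * w)) \<longlonglongrightarrow> 1"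
    by (simp add: euler_series_def)
  then have "\<forall>\<^sub>F n in sequentially. euler_series q (q ^ n * w) \<noteq> 0"
    by (rule tendsto_imp_eventually_ne) simp
  then obtain n where "euler_series q (q ^ n * w) \<noteq> 0"
    by (auto simp: eventually_sequentially)
  then have "(\<Prod>k<n. 1 - q ^ k * w) = 0"
    using euler_series_iterate[OF assms(1), of w n] assms(2) by simp
  then show thesis using that by auto
qed

section \<open>The product side of the Jacobi triple product, without its constant factor\<close>

definition jacobi_product :: "complex \<Rightarrow> complex \<Rightarrow> complex" where
  "jacobi_product \<tau> z = euler_series (unit_exp \<tau>) (unit_exp z)
     * euler_series (unit_exp \<tau>) (unit_exp \<tau> / unit_exp z)"

context
  fixes \<tau> :: complex
  assumes \<tau>: "Im \<tau> > 0"
begin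

lemma norm_nome: "norm (unit_exp \<tau>) < 1"
  using \<tau> by (simp add: norm_unit_exp)

lemma holomorphic_euler_series_nome: "euler_series (unit_exp \<tau>) holomorphic_on S"
  unfolding euler_series_def by (rule holomorphic_ratio_series[OF euler_series_ratio[OF norm_nome]])

lemma holomorphic_euler_series_nome_compose:
  "f holomorphic_on S \<Longrightarrow> (\<lambda>z. euler_series (unit_exp \<tau>) (f z)) holomorphic_on S"
  using holomorphic_on_compose_gen[OF _ holomorphic_euler_series_nome subset_UNIV]
  by (simp add: o_def)

lemma holomorphic_jacobi_product: "jacobi_product \<tau> holomorphic_on S"
proof -
  have "(\<lambda>z. unit_exp \<tau> / unit_exp z) holomorphic_on S"
    by (intro holomorphic_intros) auto
  with holomorphic_unit_exp[OF holomorphic_on_ident]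
  have "(\<lambda>z. euler_series (unit_exp \<tau>) (unit_exp z)
      * euler_series (unit_exp \<tau>) (unit_exp \<tau> / unit_exp z)) holomorphic_on S"
    by (intro holomorphic_on_mult holomorphic_euler_series_nome_compose)
  then show ?thesis by (simp add: jacobi_product_def[abs_def])
qed

lemma jacobi_product_add_1: "jacobi_product \<tau> (z + 1) = jacobi_product \<tau> z"
  by (simp add: jacobi_product_def unit_exp_add)

text \<open>The first series loses the factor \<open>1 - w\<close> and the second gains
  \<open>1 - 1 / w\<close>. Their quotient is \<open>- 1 / w\<close>; everything is multiplied out
  to allow \<open>w = 1\<close>.\<close>

lemma jacobi_product_add_tau:
  "jacobi_product \<tau> (z + \<tau>) = - unit_exp (- z) * jacobi_product \<tau> z"
proof -
  define q w where "q = unit_exp \<tau>" and "w = unit_exp z"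
  have [simp]: "w \<noteq> 0" "q \<noteq> 0" by (auto simp: w_def q_def)
  note rec = euler_series_rec[OF norm_nome, folded q_def]
  have "w * (euler_series q (w * q) * euler_series q (q / (w * q))) =
      w * ((1 - 1 / w) * (euler_series q (w * q) * euler_series q (q / w)))"
    using rec[of "1 / w"] by (simp add: mult_ac)
  also have "\<dots> = - ((1 - w) * euler_series q (w * q) * euler_series q (q / w))"
    by (simp add: field_simps)
  also have "\<dots> = - (euler_series q w * euler_series q (q / w))"
    using rec[of w] by (simp add: mult_ac)
  finally have "w * (euler_series q (w * q) * euler_series q (q / (w * q))) =
      - (euler_series q w * euler_series q (q / w))" .
  then show ?thesis
    unfolding jacobi_product_def
    by (simp add: unit_exp_add unit_exp_minus q_def[symmetric] w_def[symmetric] field_simps)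
qed

lemma jacobi_product_zero_in_lattice:
  assumes "jacobi_product \<tau> z = 0"
  shows "z \<in> lattice \<tau>"
proof -
  have "z \<in> lattice \<tau>" if "unit_exp (of_int n * \<tau> + z) = 1" for n
  proof -
    from that obtain k where "of_int n * \<tau> + z = of_int k"
      unfolding unit_exp_eq_1_iff by (elim Ints_cases)
    then have "z = of_int k + of_int (- n) * \<tau>" by (simp add: algebra_simps)
    then show ?thesis unfolding lattice_def by blast
  qed
  note lat = this
  from assms consider "euler_series (unit_exp \<tau>) (unit_exp z) = 0"
    | "euler_series (unit_exp \<tau>) (unit_exp \<tau> / unit_exp z) = 0"
    by (auto simp: jacobi_product_def)
  then show ?thesis
  proof cases
    case 1
    then obtain n where "unit_exp \<tau> ^ n * unit_exp z = 1"
      using euler_series_zero[OF norm_nome] by blast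
    then show ?thesis
      using lat[of "int n"] by (simp add: unit_exp_add unit_exp_of_nat_mult)
  next
    case 2
    then obtain n where n: "unit_exp \<tau> ^ n * (unit_exp \<tau> / unit_exp z) = 1"
      using euler_series_zero[OF norm_nome] by blast
    have "unit_exp (of_int (- int (Suc n)) * \<tau> + z) = 1 / unit_exp \<tau> ^ Suc n * unit_exp z"
      unfolding unit_exp_add unit_exp_of_int_mult
      by (simp only: power_int_minus power_int_of_nat inverse_eq_divide)
    also have "\<dots> = 1" using n by (simp add: field_simps)
    finally show ?thesis by (rule lat)
  qed
qed

lemma jacobi_product_0: "jacobi_product \<tau> 0 = 0"
  using euler_series_rec[OF norm_nome, of 1] by (simp add: jacobi_product_def)

text \<open>One step of the recursion splits off the factor \<open>1 - unit_exp z\<close>, which has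
  a simple zero at 0. A zero of the cofactor \<open>R\<close> at 0 would make a positive power of
  \<open>q\<close> equal to 1, against \<open>norm q < 1\<close>.\<close>

lemma deriv_jacobi_product_0: "deriv (jacobi_product \<tau>) 0 \<noteq> 0"
proof -
  define q where "q = unit_exp \<tau>"
  define R where "R z = euler_series q (q * unit_exp z) * euler_series q (q / unit_exp z)" for z
  have R0: "R 0 \<noteq> 0"
  proof
    assume "R 0 = 0"
    then obtain n where "q ^ n * q = 1"
      using euler_series_zero[OF norm_nome, of q] unfolding R_def q_def by auto
    then have "norm q ^ Suc n = 1"
      by (metis norm_one norm_power power_Suc2)
    then show False
      using norm_nome power_Suc_less_one[of "norm q" n] by (simp add: q_def norm_unit_exp)
  qed
  have eq: "jacobi_product \<tau> = (\<lambda>z. (1 - unit_exp z) * R z)"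
    unfolding fun_eq_iff jacobi_product_def R_def q_def
    by (subst euler_series_rec[OF norm_nome]) (simp add: mult_ac)
  have "R holomorphic_on UNIV"
    unfolding R_def q_def
    by (intro holomorphic_intros holomorphic_euler_series_nome_compose) auto
  from holomorphic_derivI[OF this open_UNIV UNIV_I]
  have "(R has_field_derivative deriv R 0) (at 0)" .
  from DERIV_mult[OF DERIV_diff[OF DERIV_const DERIV_unit_exp] this, of 1]
  have "(jacobi_product \<tau> has_field_derivative - (2 * of_real pi * \<i>) * R 0) (at 0)"
    unfolding eq by simp
  then show ?thesis using R0 by (simp add: DERIV_imp_deriv)
qed

text \<open>Being a simple zero is a lattice-invariant property: once the value vanishes, the
  derivative at the shifted point is a nonzero multiple of the one at \<open>z\<close>. This carries
  the case of 0 to all lattice points.\<close>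

lemma jacobi_product_lattice:
  assumes "z \<in> lattice \<tau>"
  shows "jacobi_product \<tau> z = 0" and "deriv (jacobi_product \<tau>) z \<noteq> 0"
proof -
  let ?J = "jacobi_product \<tau>"
  define Q where "Q z \<longleftrightarrow> ?J z = 0 \<and> deriv ?J z \<noteq> 0" for z
  have J: "(?J has_field_derivative deriv ?J z) (at z)" for z
    using holomorphic_derivI[OF holomorphic_jacobi_product open_UNIV] by blast
  have "((\<lambda>z. ?J (z + 1)) has_field_derivative deriv ?J (z + 1)) (at z)" for z
    using DERIV_shift J by blast
  then have d1: "deriv ?J (z + 1) = deriv ?J z" for z
    unfolding jacobi_product_add_1 using DERIV_unique J by blast
  have "Q (z + 1) = Q z" for z
    by (simp add: Q_def d1 jacobi_product_add_1)
  moreover have "Q (z + \<tau>) = Q z" for z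
  proof -
    have "((\<lambda>z. ?J (z + \<tau>)) has_field_derivative deriv ?J (z + \<tau>)) (at z)"
      using DERIV_shift J by blast
    moreover have "((\<lambda>z. - unit_exp (- z) * ?J z) has_field_derivative
        2 * of_real pi * \<i> * unit_exp (- z) * ?J z - unit_exp (- z) * deriv ?J z) (at z)"
      by (auto intro!: derivative_eq_intros J DERIV_chain2[OF DERIV_unit_exp])
    ultimately have "deriv ?J (z + \<tau>) =
        2 * of_real pi * \<i> * unit_exp (- z) * ?J z - unit_exp (- z) * deriv ?J z"
      unfolding jacobi_product_add_tau by (rule DERIV_unique)
    then show ?thesis by (auto simp: Q_def jacobi_product_add_tau)
  qed
  ultimately have "Q (0 + z) = Q 0"
    by (rule periodic_lattice) (rule assms)
  then have "Q z"
    by (simp add: Q_def jacobi_product_0 deriv_jacobi_product_0)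
  then show "?J z = 0" "deriv ?J z \<noteq> 0" by (auto simp: Q_def)
qed

lemma theta_lattice:
  assumes "z \<in> lattice \<tau>"
  shows "theta \<tau> z = 0"
proof -
  have "(theta \<tau> (0 + z) = 0) = (theta \<tau> 0 = 0)"
    by (rule periodic_lattice[OF _ _ assms]) (simp_all add: theta_add_1 theta_add_tau \<tau>)
  then show ?thesis using \<tau> by simp
qed

text \<open>Both functions have the same multiplier, so the quotient lemma applies with
  \<open>q = 1\<close>, and its clause for \<open>norm q = 1\<close> removes the
  exponential.\<close>

lemma theta_eq_jacobi_product:
  "\<exists>c. c \<noteq> 0 \<and> (\<forall>z. theta \<tau> z = c * jacobi_product \<tau> z)"
proof -
  let ?J = "jacobi_product \<tau>"
  have "jacobi_product \<tau> a \<noteq> 0" if "a \<notin> lattice \<tau>" for a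
    using that jacobi_product_zero_in_lattice by blast
  moreover have "\<exists>a. a \<notin> lattice \<tau>"
    using theta_not_identically_zero[OF \<tau>] theta_lattice by metis
  ultimately obtain a where a: "?J a \<noteq> 0" by blast
  have simple: "theta \<tau> z = 0 \<and> deriv ?J z \<noteq> 0" if "?J z = 0" for z
    using jacobi_product_zero_in_lattice[OF that] theta_lattice jacobi_product_lattice by blast
  have "\<exists>c e. (\<forall>z. theta \<tau> z = c * unit_exp (- (of_real e * z)) * ?J z) \<and>
      (norm (1::complex) = 1 \<longrightarrow> e = 0) \<and>
      (c \<noteq> 0 \<longrightarrow> unit_exp (of_real e) = 1 \<and> 1 * unit_exp (of_real e * \<tau>) = 1)"
  proof (rule entire_quotient_quasi_periodic[where m = "\<lambda>z. - unit_exp (- z)", OF _ _ a simple \<tau>])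
    show "theta \<tau> holomorphic_on UNIV"
      using holomorphic_theta[OF holomorphic_on_ident \<tau>] .
  qed (simp_all add: theta_add_1 theta_add_tau jacobi_product_add_1 jacobi_product_add_tau
      holomorphic_jacobi_product \<tau>)
  then obtain c where c: "\<And>z. theta \<tau> z = c * ?J z" by auto
  then have "c \<noteq> 0" using theta_not_identically_zero[OF \<tau>] by (metis mult_zero_left)
  then show ?thesis using c by blast
qed

lemma theta_eq_0_iff: "theta \<tau> z = 0 \<longleftrightarrow> z \<in> lattice \<tau>"
proof
  assume "theta \<tau> z = 0"
  then have "jacobi_product \<tau> z = 0" using theta_eq_jacobi_product by auto
  then show "z \<in> lattice \<tau>" by (rule jacobi_product_zero_in_lattice)
qed (rule theta_lattice)

lemma deriv_theta_lattice:
  assumes "z \<in> lattice \<tau>"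
  shows "deriv (theta \<tau>) z \<noteq> 0"
proof -
  obtain c where c: "c \<noteq> 0" "\<And>z. theta \<tau> z = c * jacobi_product \<tau> z"
    using theta_eq_jacobi_product by blast
  have "theta \<tau> = (\<lambda>z. c * jacobi_product \<tau> z)" using c(2) by blast
  moreover have "deriv (\<lambda>z. c * jacobi_product \<tau> z) z = c * deriv (jacobi_product \<tau>) z"
    using holomorphic_jacobi_product[of UNIV] holomorphic_on_imp_differentiable_at[of _ UNIV]
    by (intro deriv_cmult) auto
  ultimately show ?thesis using c(1) jacobi_product_lattice(2)[OF assms] by simp
qed

end

section \<open>Quadratic relations between quotients of theta functions\<close>

lemma lattice_diff:
  assumes "a \<in> lattice \<tau>" and "b \<in> lattice \<tau>"
  shows "a - b \<in> lattice \<tau>"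
proof -
  from assms obtain i j k l where "a = of_int i + of_int j * \<tau>" "b = of_int k + of_int l * \<tau>"
    unfolding lattice_def by blast
  then have "a - b = of_int (i - k) + of_int (j - l) * \<tau>" by (simp add: algebra_simps)
  then show ?thesis unfolding lattice_def by blast
qed

text \<open>The products \<open>f\<^sub>i f\<^sub>k\<close> cleared of denominators, so that they are entire.\<close>

definition pair_term ::
  "complex \<Rightarrow> complex \<Rightarrow> complex ^ 'n::finite \<Rightarrow> 'n \<Rightarrow> 'n \<Rightarrow> complex \<Rightarrow> complex" where
  "pair_term \<tau> \<eta> v i k z = theta \<tau> (z - v $ i + \<eta>) * theta \<tau> (z - v $ k + \<eta>) *
     (\<Prod>m\<in>UNIV - {i, k}. theta \<tau> (z - v $ m))"

definition pair_sum ::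
  "complex \<Rightarrow> complex \<Rightarrow> complex ^ 'n::finite \<Rightarrow> ('n \<Rightarrow> 'n \<Rightarrow> complex) \<Rightarrow> complex \<Rightarrow> complex" where
  "pair_sum \<tau> \<eta> v S z = (\<Sum>i\<in>UNIV. \<Sum>k\<in>UNIV - {i}. S i k * pair_term \<tau> \<eta> v i k z)"

definition theta_quot ::
  "complex \<Rightarrow> complex \<Rightarrow> complex ^ 'n::finite \<Rightarrow> 'n \<Rightarrow> complex \<Rightarrow> complex" where
  "theta_quot \<tau> \<eta> v k z = theta \<tau> (z - v $ k + \<eta>) / theta \<tau> (z - v $ k)"

definition theta_prod :: "complex \<Rightarrow> complex ^ 'n::finite \<Rightarrow> complex \<Rightarrow> complex" where
  "theta_prod \<tau> v z = (\<Prod>m\<in>UNIV. theta \<tau> (z - v $ m))"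

lemma pair_term_commute: "pair_term \<tau> \<eta> v i k = pair_term \<tau> \<eta> v k i"
  by (simp add: fun_eq_iff pair_term_def insert_commute mult_ac)

lemma prod_UNIV_remove2:
  fixes f :: "'n::finite \<Rightarrow> 'a::comm_monoid_mult"
  assumes "i \<noteq> k"
  shows "prod f UNIV = f i * f k * prod f (UNIV - {i, k})"
proof -
  have "prod f UNIV = f i * prod f (UNIV - {i})" by (rule prod.remove) auto
  also have "prod f (UNIV - {i}) = f k * prod f (UNIV - {i} - {k})"
    using assms by (intro prod.remove) auto
  also have "UNIV - {i} - {k} = UNIV - {i, k}" by auto
  finally show ?thesis by (simp add: mult.assoc)
qed

context
  fixes \<tau> \<eta> :: complex and v :: "complex ^ 'n::finite"
  assumes \<tau>: "Im \<tau> > 0" and \<eta>: "\<eta> \<notin> lattice \<tau>"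
    and distinct: "\<And>i j. i \<noteq> j \<Longrightarrow> v $ i - v $ j \<notin> lattice \<tau>"
begin

lemma pair_sum_eq_theta_prod_mult:
  assumes "\<And>m. z - v $ m \<notin> lattice \<tau>"
  shows "pair_sum \<tau> \<eta> v S z = theta_prod \<tau> v z *
    (\<Sum>i\<in>UNIV. \<Sum>k\<in>UNIV - {i}. S i k * (theta_quot \<tau> \<eta> v i z * theta_quot \<tau> \<eta> v k z))"
proof -
  have nz: "theta \<tau> (z - v $ m) \<noteq> 0" for m
    using assms theta_eq_0_iff[OF \<tau>] by blast
  have "pair_term \<tau> \<eta> v i k z =
      theta_prod \<tau> v z * (theta_quot \<tau> \<eta> v i z * theta_quot \<tau> \<eta> v k z)" if "i \<noteq> k" for i k
    using nz unfolding theta_prod_def prod_UNIV_remove2[OF that] pair_term_def theta_quot_def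
    by simp
  then show ?thesis
    unfolding pair_sum_def sum_distrib_left by (intro sum.cong refl) (auto simp: mult_ac)
qed

text \<open>The remaining product still contains the factor for \<open>j\<close>, which is theta at
  0.\<close>

lemma pair_term_at_other:
  assumes "i \<noteq> j" and "k \<noteq> j"
  shows "pair_term \<tau> \<eta> v i k (v $ j) = 0"
proof -
  have "(\<Prod>m\<in>UNIV - {i, k}. theta \<tau> (v $ j - v $ m)) = 0"
    using assms \<tau> by (intro prod_zero bexI[of _ j]) auto
  then show ?thesis by (simp add: pair_term_def)
qed

text \<open>Only the pairs containing \<open>j\<close> survive. Each is counted in both orders, and
  symmetry of \<open>S\<close> merges them into the factor 2.\<close>

lemma pair_sum_at_point:
  assumes sym: "\<And>i k. S i k = S k i"
  shows "pair_sum \<tau> \<eta> v S (v $ j) = 2 * theta \<tau> \<eta> * (\<Prod>m\<in>UNIV - {j}. theta \<tau> (v $ j - v $ m)) *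
    (\<Sum>k\<in>UNIV - {j}. S j k * theta_quot \<tau> \<eta> v k (v $ j))"
proof -
  let ?T = "\<lambda>i k. S i k * pair_term \<tau> \<eta> v i k (v $ j)"
  have T: "?T j k = theta \<tau> \<eta> * (\<Prod>m\<in>UNIV - {j}. theta \<tau> (v $ j - v $ m)) *
      (S j k * theta_quot \<tau> \<eta> v k (v $ j))" if "k \<noteq> j" for k
  proof -
    have "theta \<tau> (v $ j - v $ k) \<noteq> 0"
      using distinct[of j k] that by (auto simp: theta_eq_0_iff[OF \<tau>])
    moreover have "UNIV - {j} - {k} = UNIV - {j, k}" by auto
    then have "(\<Prod>m\<in>UNIV - {j}. theta \<tau> (v $ j - v $ m)) =
        theta \<tau> (v $ j - v $ k) * (\<Prod>m\<in>UNIV - {j, k}. theta \<tau> (v $ j - v $ m))"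
      using that prod.remove[of "UNIV - {j}" k "\<lambda>m. theta \<tau> (v $ j - v $ m)"] by simp
    ultimately show ?thesis unfolding pair_term_def theta_quot_def by simp
  qed
  have inner: "(\<Sum>k\<in>UNIV - {i}. ?T i k) = ?T j i" if "i \<noteq> j" for i
  proof -
    have "(\<Sum>k\<in>UNIV - {i}. ?T i k) = (\<Sum>k\<in>{j}. ?T i k)"
      using that pair_term_at_other by (intro sum.mono_neutral_right) auto
    then show ?thesis using sym[of i j] by (simp add: pair_term_commute[of _ _ _ i j])
  qed
  have "pair_sum \<tau> \<eta> v S (v $ j) =
      (\<Sum>k\<in>UNIV - {j}. ?T j k) + (\<Sum>i\<in>UNIV - {j}. \<Sum>k\<in>UNIV - {i}. ?T i k)"
    unfolding pair_sum_def by (rule sum.remove) auto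
  also have "(\<Sum>i\<in>UNIV - {j}. \<Sum>k\<in>UNIV - {i}. ?T i k) = (\<Sum>i\<in>UNIV - {j}. ?T j i)"
    by (intro sum.cong inner) auto
  also have "(\<Sum>k\<in>UNIV - {j}. ?T j k) =
      theta \<tau> \<eta> * (\<Prod>m\<in>UNIV - {j}. theta \<tau> (v $ j - v $ m)) *
      (\<Sum>k\<in>UNIV - {j}. S j k * theta_quot \<tau> \<eta> v k (v $ j))"
    unfolding sum_distrib_left by (intro sum.cong T) auto
  finally show ?thesis by (simp only: mult_2 distrib_right mult.assoc)
qed

lemma holomorphic_pair_sum: "pair_sum \<tau> \<eta> v S holomorphic_on A"
  unfolding pair_sum_def[abs_def] pair_term_def by (intro holomorphic_intros \<tau>)

lemma holomorphic_theta_prod: "theta_prod \<tau> v holomorphic_on A"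
  unfolding theta_prod_def[abs_def] by (intro holomorphic_intros \<tau>)

lemma pair_sum_add_1: "pair_sum \<tau> \<eta> v S (z + 1) = pair_sum \<tau> \<eta> v S z"
proof -
  have "theta \<tau> (z + 1 - a) = theta \<tau> (z - a)" "theta \<tau> (z + 1 - a + \<eta>) = theta \<tau> (z - a + \<eta>)" for a
    using theta_add_1[OF \<tau>, of "z - a"] theta_add_1[OF \<tau>, of "z - a + \<eta>"]
    by (simp_all add: algebra_simps)
  then show ?thesis unfolding pair_sum_def pair_term_def by simp
qed

lemma theta_prod_add_1: "theta_prod \<tau> v (z + 1) = theta_prod \<tau> v z"
proof -
  have "theta \<tau> (z + 1 - a) = theta \<tau> (z - a)" for a
    using theta_add_1[OF \<tau>, of "z - a"] by (simp add: algebra_simps)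
  then show ?thesis unfolding theta_prod_def by simp
qed

lemma theta_prod_add_tau:
  "theta_prod \<tau> v (z + \<tau>) = (\<Prod>m\<in>UNIV. - unit_exp (- (z - v $ m))) * theta_prod \<tau> v z"
proof -
  have "theta \<tau> (z + \<tau> - a) = - unit_exp (- (z - a)) * theta \<tau> (z - a)" for a
    using theta_add_tau[OF \<tau>, of "z - a"] by (simp add: algebra_simps)
  then show ?thesis unfolding theta_prod_def by (simp only: prod.distrib)
qed

text \<open>Each summand has as many theta factors as \<open>theta_prod\<close>. The two arguments
  moved by \<eta> each contribute an extra \<open>unit_exp (- \<eta>)\<close>.\<close>

lemma pair_sum_add_tau:
  "pair_sum \<tau> \<eta> v S (z + \<tau>) =
    unit_exp (- (2 * \<eta>)) * (\<Prod>m\<in>UNIV. - unit_exp (- (z - v $ m))) * pair_sum \<tau> \<eta> v S z"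
proof -
  define \<mu> where "\<mu> a = - unit_exp (- (z - a))" for a
  have shift: "theta \<tau> (z + \<tau> - a) = \<mu> a * theta \<tau> (z - a)" for a
    using theta_add_tau[OF \<tau>, of "z - a"] by (simp add: algebra_simps \<mu>_def)
  have shift\<eta>: "theta \<tau> (z + \<tau> - a + \<eta>) = unit_exp (- \<eta>) * \<mu> a * theta \<tau> (z - a + \<eta>)" for a
  proof -
    have "theta \<tau> (z + \<tau> - a + \<eta>) = - unit_exp (- (z - a + \<eta>)) * theta \<tau> (z - a + \<eta>)"
      using theta_add_tau[OF \<tau>, of "z - a + \<eta>"] by (simp add: algebra_simps)
    also have "unit_exp (- (z - a + \<eta>)) = unit_exp (- \<eta>) * unit_exp (- (z - a))"
      unfolding unit_exp_add[symmetric] by (simp add: algebra_simps)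
    finally show ?thesis by (simp add: \<mu>_def)
  qed
  have \<eta>2: "unit_exp (- (2 * \<eta>)) = unit_exp (- \<eta>) * unit_exp (- \<eta>)"
    unfolding unit_exp_add[symmetric] by simp
  have "pair_term \<tau> \<eta> v i k (z + \<tau>) =
      unit_exp (- (2 * \<eta>)) * (\<Prod>m\<in>UNIV. \<mu> (v $ m)) * pair_term \<tau> \<eta> v i k z" if "i \<noteq> k" for i k
    unfolding pair_term_def shift shift\<eta> prod.distrib \<eta>2 prod_UNIV_remove2[OF that, of "\<lambda>m. \<mu> (v $ m)"]
    by (simp only: mult_ac)
  then show ?thesis
    unfolding pair_sum_def sum_distrib_left \<mu>_def by (intro sum.cong refl) (auto simp: mult_ac)
qed

text \<open>Two factors vanishing at \<open>z\<close> would put the difference of two points in the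
  lattice, so exactly one factor vanishes, and its zero is simple.\<close>

lemma theta_prod_zero:
  assumes "theta_prod \<tau> v z = 0"
  obtains m where "z - v $ m \<in> lattice \<tau>" and "deriv (theta_prod \<tau> v) z \<noteq> 0"
proof -
  from assms obtain m where m: "z - v $ m \<in> lattice \<tau>"
    unfolding theta_prod_def using theta_eq_0_iff[OF \<tau>] by auto
  define R where "R = (\<lambda>z. \<Prod>l\<in>UNIV - {m}. theta \<tau> (z - v $ l))"
  have eq: "theta_prod \<tau> v = (\<lambda>z. theta \<tau> (z - v $ m) * R z)"
    unfolding theta_prod_def[abs_def] R_def by (intro ext prod.remove) auto
  have "z - v $ l \<notin> lattice \<tau>" if "l \<noteq> m" for l
    using lattice_diff[OF m, of "z - v $ l"] distinct[OF that] by auto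
  then have "R z \<noteq> 0"
    unfolding R_def using theta_eq_0_iff[OF \<tau>] by auto
  have "R holomorphic_on UNIV"
    unfolding R_def by (intro holomorphic_intros \<tau>)
  from holomorphic_derivI[OF this open_UNIV UNIV_I]
  have R': "(R has_field_derivative deriv R z) (at z)" .
  from holomorphic_derivI[OF holomorphic_theta[OF holomorphic_on_ident \<tau>] open_UNIV UNIV_I]
  have "(theta \<tau> has_field_derivative deriv (theta \<tau>) (z - v $ m)) (at (z - v $ m))" .
  then have "((\<lambda>z. theta \<tau> (z - v $ m)) has_field_derivative deriv (theta \<tau>) (z - v $ m)) (at z)"
    using DERIV_shift[of "theta \<tau>" _ z "- v $ m"] by simp
  from DERIV_mult[OF this R']
  have "(theta_prod \<tau> v has_field_derivative deriv (theta \<tau>) (z - v $ m) * R z) (at z)"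
    unfolding eq using theta_lattice[OF \<tau> m] by simp
  then have "deriv (theta_prod \<tau> v) z = deriv (theta \<tau>) (z - v $ m) * R z"
    by (rule DERIV_imp_deriv)
  then show thesis
    using that[OF m] \<open>R z \<noteq> 0\<close> deriv_theta_lattice[OF \<tau> m] by simp
qed

text \<open>The quotients have poles at the points \<open>v $ j\<close>, but the cleared relation is
  entire. It vanishes on \<open>T\<close>, hence also at these points, where its value is a nonzero
  multiple of the sum.\<close>

lemma theta_quot_relation_at_points:
  assumes sym: "\<And>i k. S i k = S k i"
    and "open T" and "T \<noteq> {}" and generic: "\<And>z m. z \<in> T \<Longrightarrow> z - v $ m \<notin> lattice \<tau>"
    and zero: "\<And>z. z \<in> T \<Longrightarrow>
      (\<Sum>i\<in>UNIV. \<Sum>k\<in>UNIV - {i}. S i k * (theta_quot \<tau> \<eta> v i z * theta_quot \<tau> \<eta> v k z)) = 0"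
  shows "(\<Sum>k\<in>UNIV - {j}. S j k * theta_quot \<tau> \<eta> v k (v $ j)) = 0"
proof -
  have "pair_sum \<tau> \<eta> v S z = 0" if "z \<in> T" for z
    using pair_sum_eq_theta_prod_mult[of z S] generic[OF that] zero[OF that] by simp
  then have "pair_sum \<tau> \<eta> v S (v $ j) = 0"
    using analytic_continuation_open[OF \<open>open T\<close> open_UNIV \<open>T \<noteq> {}\<close> connected_UNIV subset_UNIV
        holomorphic_pair_sum holomorphic_on_const[of 0]] by blast
  moreover have "theta \<tau> \<eta> \<noteq> 0" using \<eta> theta_eq_0_iff[OF \<tau>] by blast
  moreover have "(\<Prod>m\<in>UNIV - {j}. theta \<tau> (v $ j - v $ m)) \<noteq> 0"
    using distinct[of j] theta_eq_0_iff[OF \<tau>] by auto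
  ultimately show ?thesis
    unfolding pair_sum_at_point[of S, OF sym] by simp
qed

text \<open>The hypothesis makes \<open>pair_sum\<close> vanish at every zero of
  \<open>theta_prod\<close>, so their quotient is \<open>c\<close> times an exponential.\<close>

lemma theta_quot_relation_everywhere:
  assumes sym: "\<And>i k. S i k = S k i" and "2 * \<eta> \<notin> lattice \<tau>"
    and zero: "\<And>j. (\<Sum>k\<in>UNIV - {j}. S j k * theta_quot \<tau> \<eta> v k (v $ j)) = 0"
    and generic: "\<And>m. z - v $ m \<notin> lattice \<tau>"
  shows "(\<Sum>i\<in>UNIV. \<Sum>k\<in>UNIV - {i}. S i k * (theta_quot \<tau> \<eta> v i z * theta_quot \<tau> \<eta> v k z)) = 0"
proof -
  let ?N = "pair_sum \<tau> \<eta> v S" and ?P = "theta_prod \<tau> v"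
  let ?m = "\<lambda>z. \<Prod>m\<in>UNIV. - unit_exp (- (z - v $ m))"
  have Pz: "?P z \<noteq> 0"
    unfolding theta_prod_def using generic theta_eq_0_iff[OF \<tau>] by auto
  have m: "?m w \<noteq> 0" for w by simp
  have N: "?N w = 0 \<and> deriv ?P w \<noteq> 0" if w: "?P w = 0" for w
  proof -
    obtain j where j: "w - v $ j \<in> lattice \<tau>" "deriv ?P w \<noteq> 0"
      using theta_prod_zero[OF w] .
    \<comment> \<open>Zeros of \<open>theta_prod\<close> are lattice translates of the points, and
      vanishing of \<open>pair_sum\<close> is lattice-invariant.\<close>
    have "(?N (v $ j + (w - v $ j)) = 0) = (?N (v $ j) = 0)"
      by (rule periodic_lattice[OF _ _ j(1), of "\<lambda>w. ?N w = 0"])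
        (simp_all add: pair_sum_add_1 pair_sum_add_tau)
    moreover have "?N (v $ j) = 0"
      unfolding pair_sum_at_point[of S, OF sym] zero by simp
    ultimately show ?thesis using j(2) by simp
  qed
  have "\<exists>c a. (\<forall>z. ?N z = c * unit_exp (- (of_real a * z)) * ?P z) \<and>
      (norm (unit_exp (- (2 * \<eta>))) = 1 \<longrightarrow> a = 0) \<and>
      (c \<noteq> 0 \<longrightarrow> unit_exp (of_real a) = 1 \<and> unit_exp (- (2 * \<eta>)) * unit_exp (of_real a * \<tau>) = 1)"
    by (rule entire_quotient_quasi_periodic[OF holomorphic_pair_sum holomorphic_theta_prod Pz N \<tau>
          unit_exp_nonzero pair_sum_add_1 theta_prod_add_1 pair_sum_add_tau theta_prod_add_tau m])
  then obtain c a where c: "\<And>z. ?N z = c * unit_exp (- (of_real a * z)) * ?P z"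
    and a: "c \<noteq> 0 \<Longrightarrow> unit_exp (of_real a) = 1 \<and> unit_exp (- (2 * \<eta>) + of_real a * \<tau>) = 1"
    unfolding unit_exp_add by blast
  \<comment> \<open>A nonzero \<open>c\<close> makes \<open>a\<close> an integer, by the period 1,
    and then 2 \<eta> differs from \<open>a\<close> times \<tau> by an integer.\<close>
  have "c = 0"
  proof (rule ccontr)
    assume "c \<noteq> 0"
    then obtain k l where k: "complex_of_real a = of_int k" and l: "- (2 * \<eta>) + of_real a * \<tau> = of_int l"
      using a unfolding unit_exp_eq_1_iff by (auto elim!: Ints_cases)
    have "2 * \<eta> = of_int (- l) + of_int k * \<tau>"
      using l unfolding k by (simp add: algebra_simps)
    then show False using \<open>2 * \<eta> \<notin> lattice \<tau>\<close> unfolding lattice_def by blast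
  qed
  then show ?thesis
    using c[of z] Pz pair_sum_eq_theta_prod_mult[of z S] generic by simp
qed

end

section \<open>From the compatibility condition to a symmetric quadratic relation\<close>

lemma sum_symmetrize_offdiag:
  fixes A :: "'n::finite \<Rightarrow> 'n \<Rightarrow> complex"
  assumes "\<And>i. A i i = 0"
  shows "(\<Sum>i\<in>UNIV. \<Sum>k\<in>UNIV - {i}. (A i k + A k i) * (f i * f k)) =
    2 * (\<Sum>i\<in>UNIV. \<Sum>k\<in>UNIV. A i k * (f i * f k))"
proof -
  have "(\<Sum>i\<in>UNIV. \<Sum>k\<in>UNIV - {i}. (A i k + A k i) * (f i * f k)) =
      (\<Sum>i\<in>UNIV. \<Sum>k\<in>UNIV. (A i k + A k i) * (f i * f k))"
    using assms by (intro sum.cong refl sum.mono_neutral_left) auto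
  also have "\<dots> = (\<Sum>i\<in>UNIV. \<Sum>k\<in>UNIV. A i k * (f i * f k)) + (\<Sum>i\<in>UNIV. \<Sum>k\<in>UNIV. A k i * (f i * f k))"
    by (simp only: distrib_right sum.distrib)
  also have "(\<Sum>i\<in>UNIV. \<Sum>k\<in>UNIV. A k i * (f i * f k)) = (\<Sum>i\<in>UNIV. \<Sum>k\<in>UNIV. A i k * (f i * f k))"
    by (subst sum.swap) (simp only: mult_ac)
  finally show ?thesis by simp
qed

text \<open>Dividing each \<open>psi\<close> by the full product leaves one theta quotient. At
  \<open>v $ i\<close> every \<open>psi\<close> with another index contains theta at 0, so
  \<open>chi_comb\<close> collapses to one term, which cancels the prefactor.\<close>

lemma K_derivatives:
  fixes v :: "complex ^ 'n::finite"
  assumes \<tau>: "Im \<tau> > 0" and \<eta>: "\<eta> \<notin> lattice \<tau>"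
    and K: "satisfies_K_equations \<tau> \<eta> c D K" and D: "(z, v) \<in> D" "D \<subseteq> generic_points \<tau>"
  shows "d_zeta K z v = (\<Sum>k\<in>UNIV. c $ k * theta_quot \<tau> \<eta> v k z)"
    and "d_u K i z v = - (c $ i * theta_quot \<tau> \<eta> v i z)"
proof -
  from D have distinct: "\<And>i j. i \<noteq> j \<Longrightarrow> v $ i - v $ j \<notin> lattice \<tau>"
    and generic: "\<And>i. z - v $ i \<notin> lattice \<tau>"
    by (auto simp: generic_points_def)
  note nz = theta_eq_0_iff[OF \<tau>]
  have "d_zeta K z v = chi_comb \<tau> \<eta> c v z / (\<Prod>m\<in>UNIV. theta \<tau> (z - v $ m))"
    unfolding d_zeta_def using K D(1)
    by (intro DERIV_imp_deriv) (auto simp: satisfies_K_equations_def)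
  also have "\<dots> = (\<Sum>k\<in>UNIV. c $ k * theta_quot \<tau> \<eta> v k z)"
    unfolding chi_comb_def sum_divide_distrib
  proof (intro sum.cong refl)
    fix k
    have "(\<Prod>m\<in>UNIV. theta \<tau> (z - v $ m)) =
        theta \<tau> (z - v $ k) * (\<Prod>m\<in>UNIV - {k}. theta \<tau> (z - v $ m))"
      by (rule prod.remove) auto
    moreover have "(\<Prod>m\<in>UNIV - {k}. theta \<tau> (z - v $ m)) \<noteq> 0"
      using generic nz by auto
    ultimately show "c $ k * psi \<tau> \<eta> v k z / (\<Prod>m\<in>UNIV. theta \<tau> (z - v $ m)) =
        c $ k * theta_quot \<tau> \<eta> v k z"
      by (simp add: psi_def theta_quot_def)
  qed
  finally show "d_zeta K z v = (\<Sum>k\<in>UNIV. c $ k * theta_quot \<tau> \<eta> v k z)" .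
  let ?Q = "\<Prod>m\<in>UNIV - {i}. theta \<tau> (v $ i - v $ m)"
  have psi0: "psi \<tau> \<eta> v k (v $ i) = 0" if "k \<noteq> i" for k
  proof -
    have "(\<Prod>m\<in>UNIV - {k}. theta \<tau> (v $ i - v $ m)) = 0"
      using that \<tau> by (intro prod_zero bexI[of _ i]) auto
    then show ?thesis by (simp add: psi_def)
  qed
  have "chi_comb \<tau> \<eta> c v (v $ i) = (\<Sum>k\<in>{i}. c $ k * psi \<tau> \<eta> v k (v $ i))"
    unfolding chi_comb_def using psi0 by (intro sum.mono_neutral_right) auto
  then have chi: "chi_comb \<tau> \<eta> c v (v $ i) = c $ i * (theta \<tau> \<eta> * ?Q)"
    by (simp add: psi_def)
  have "d_u K i z v = - (1 / ?Q) * (theta \<tau> (z - v $ i + \<eta>) / (theta \<tau> \<eta> * theta \<tau> (z - v $ i)))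
      * chi_comb \<tau> \<eta> c v (v $ i)"
    unfolding d_u_def using K D(1)
    by (intro DERIV_imp_deriv) (auto simp: satisfies_K_equations_def)
  moreover have "?Q \<noteq> 0" "theta \<tau> \<eta> \<noteq> 0"
    using distinct[of i] \<eta> nz by auto
  ultimately show "d_u K i z v = - (c $ i * theta_quot \<tau> \<eta> v i z)"
    unfolding chi theta_quot_def by simp
qed

theorem proposition6:
  fixes \<tau> \<eta> :: complex
    and \<alpha> \<beta> \<gamma> :: "complex ^ 'n::finite"
    and F G H :: "complex \<Rightarrow> complex ^ 'n \<Rightarrow> complex"
    and D :: "(complex \<times> (complex ^ 'n)) set"
    and W :: "(complex \<times> complex \<times> complex) set"
    and u :: "complex \<times> complex \<times> complex \<Rightarrow> complex ^ 'n"
  assumes "Im \<tau> > 0"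
    and "CARD('n) \<ge> 3"
    and "\<eta> \<notin> lattice \<tau>"
    and "open D" and "D \<subseteq> generic_points \<tau>"
    and "\<And>v. v \<in> snd ` D \<Longrightarrow>
           lin_indep3 (chi_comb \<tau> \<eta> \<alpha> v) (chi_comb \<tau> \<eta> \<beta> v) (chi_comb \<tau> \<eta> \<gamma> v)"
    and "satisfies_K_equations \<tau> \<eta> \<alpha> D F"
    and "satisfies_K_equations \<tau> \<eta> \<beta> D G"
    and "satisfies_K_equations \<tau> \<eta> \<gamma> D H"
    and "open W" and "holomorphic_map_on u W" and "u ` W \<subseteq> snd ` D"
  shows "(compatibility_condition F G H D W u \<longrightarrow> elliptic_system \<tau> \<eta> \<alpha> \<beta> \<gamma> W u) \<and>
         (2 * \<eta> \<notin> lattice \<tau> \<longrightarrow>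
            (compatibility_condition F G H D W u \<longleftrightarrow> elliptic_system \<tau> \<eta> \<alpha> \<beta> \<gamma> W u))"
proof -
  \<comment> \<open>The coefficient of \<open>f\<^sub>i f\<^sub>k\<close> in the compatibility
    condition, with the minus sign of the derivatives in the \<open>u $ i\<close> absorbed. It
    vanishes for equal indices.\<close>
  define A where "A p i k = (\<beta> $ k * \<gamma> $ i - \<gamma> $ k * \<beta> $ i) * dy u i p
      + (\<gamma> $ k * \<alpha> $ i - \<alpha> $ k * \<gamma> $ i) * dt u i p
      + (\<alpha> $ k * \<beta> $ i - \<beta> $ k * \<alpha> $ i) * dx u i p" for p i k
  define S where "S p i k = A p i k + A p k i" for p i k
  have sym: "S p i k = S p k i" for p i k by (simp add: S_def add.commute)
  let ?f = "\<lambda>p i z. theta_quot \<tau> \<eta> (u p) i z"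
  let ?E = "\<lambda>p z. \<Sum>i\<in>UNIV. \<Sum>k\<in>UNIV - {i}. S p i k * (?f p i z * ?f p k z)"
  note K = K_derivatives[OF assms(1,3) _ _ assms(5)]
  have compat: "compatibility_condition F G H D W u \<longleftrightarrow>
      (\<forall>p\<in>W. \<forall>z. (z, u p) \<in> D \<longrightarrow> ?E p z = 0)"
  proof -
    have eq: "?E p z = 2 *
       ((\<Sum>i\<in>UNIV. (d_zeta H z (u p) * d_u G i z (u p) - d_zeta G z (u p) * d_u H i z (u p)) * dy u i p)
      + (\<Sum>i\<in>UNIV. (d_zeta F z (u p) * d_u H i z (u p) - d_zeta H z (u p) * d_u F i z (u p)) * dt u i p)
      + (\<Sum>i\<in>UNIV. (d_zeta G z (u p) * d_u F i z (u p) - d_zeta F z (u p) * d_u G i z (u p)) * dx u i p))"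
      if D: "(z, u p) \<in> D" for p z
    proof -
      have "?E p z = 2 * (\<Sum>i\<in>UNIV. \<Sum>k\<in>UNIV. A p i k * (?f p i z * ?f p k z))"
        unfolding S_def by (rule sum_symmetrize_offdiag) (simp add: A_def)
      also have "(\<Sum>i\<in>UNIV. \<Sum>k\<in>UNIV. A p i k * (?f p i z * ?f p k z)) =
          (\<Sum>i\<in>UNIV. (d_zeta H z (u p) * d_u G i z (u p) - d_zeta G z (u p) * d_u H i z (u p)) * dy u i p
            + (d_zeta F z (u p) * d_u H i z (u p) - d_zeta H z (u p) * d_u F i z (u p)) * dt u i p
            + (d_zeta G z (u p) * d_u F i z (u p) - d_zeta F z (u p) * d_u G i z (u p)) * dx u i p)"
      proof (intro sum.cong refl)
        fix i
        \<comment> \<open>The three sums split off here are the \<zeta>-derivatives of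
          \<open>H\<close>, \<open>G\<close> and \<open>F\<close>.\<close>
        have "(\<Sum>k\<in>UNIV. A p i k * (?f p i z * ?f p k z)) =
           (\<Sum>k\<in>UNIV. \<gamma> $ k * ?f p k z) * (?f p i z * (\<alpha> $ i * dt u i p - \<beta> $ i * dy u i p))
         + (\<Sum>k\<in>UNIV. \<beta> $ k * ?f p k z) * (?f p i z * (\<gamma> $ i * dy u i p - \<alpha> $ i * dx u i p))
         + (\<Sum>k\<in>UNIV. \<alpha> $ k * ?f p k z) * (?f p i z * (\<beta> $ i * dx u i p - \<gamma> $ i * dt u i p))"
          unfolding sum_distrib_right sum.distrib[symmetric] A_def
          by (intro sum.cong refl) (simp add: algebra_simps)
        then show "(\<Sum>k\<in>UNIV. A p i k * (?f p i z * ?f p k z)) =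
            (d_zeta H z (u p) * d_u G i z (u p) - d_zeta G z (u p) * d_u H i z (u p)) * dy u i p
          + (d_zeta F z (u p) * d_u H i z (u p) - d_zeta H z (u p) * d_u F i z (u p)) * dt u i p
          + (d_zeta G z (u p) * d_u F i z (u p) - d_zeta F z (u p) * d_u G i z (u p)) * dx u i p"
          unfolding K[OF assms(7) D] K[OF assms(8) D] K[OF assms(9) D]
          by (simp add: algebra_simps)
      qed
      finally show ?thesis by (simp only: sum.distrib)
    qed
    show ?thesis
      unfolding compatibility_condition_def
    proof (intro ball_cong refl all_cong1 imp_cong)
      fix p z assume "(z, u p) \<in> D"
      from eq[OF this] show "((\<Sum>i\<in>UNIV. (d_zeta H z (u p) * d_u G i z (u p) - d_zeta G z (u p) * d_u H i z (u p)) * dy u i p)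
      + (\<Sum>i\<in>UNIV. (d_zeta F z (u p) * d_u H i z (u p) - d_zeta H z (u p) * d_u F i z (u p)) * dt u i p)
      + (\<Sum>i\<in>UNIV. (d_zeta G z (u p) * d_u F i z (u p) - d_zeta F z (u p) * d_u G i z (u p)) * dx u i p) = 0)
        \<longleftrightarrow> (?E p z = 0)"
        by (simp only: mult_eq_0_iff) simp
    qed
  qed
  have elliptic: "elliptic_system \<tau> \<eta> \<alpha> \<beta> \<gamma> W u \<longleftrightarrow>
      (\<forall>p\<in>W. \<forall>j. (\<Sum>k\<in>UNIV - {j}. S p j k * ?f p k (u p $ j)) = 0)"
  proof -
    \<comment> \<open>The coefficients in \<open>A\<close> are antisymmetric in the two indices, so
      symmetrizing leaves only differences of derivatives.\<close>
    have S: "(\<gamma> $ i * \<alpha> $ j - \<gamma> $ j * \<alpha> $ i) * (dt u i p - dt u j p)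
       + (\<alpha> $ i * \<beta> $ j - \<alpha> $ j * \<beta> $ i) * (dx u i p - dx u j p)
       + (\<beta> $ i * \<gamma> $ j - \<beta> $ j * \<gamma> $ i) * (dy u i p - dy u j p) = - S p j i" for p i j
      by (simp add: S_def A_def algebra_simps)
    show ?thesis
      unfolding elliptic_system_def S
      by (simp add: theta_quot_def sum_negf mult.commute)
  qed
  have generic: "z - u p $ m \<notin> lattice \<tau>" if "(z, u p) \<in> D" for p z m
    using that assms(5) by (auto simp: generic_points_def)
  have distinct: "u p $ i - u p $ j \<notin> lattice \<tau>" if "p \<in> W" "i \<noteq> j" for p i j
  proof -
    obtain z where "(z, u p) \<in> D" using \<open>p \<in> W\<close> assms(12) by (fastforce simp: image_subset_iff)
    then show ?thesis using assms(5) that by (auto simp: generic_points_def)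
  qed
  have "elliptic_system \<tau> \<eta> \<alpha> \<beta> \<gamma> W u" if "compatibility_condition F G H D W u"
    unfolding elliptic
  proof (intro ballI allI)
    fix p j assume p: "p \<in> W"
    let ?T = "{z. (z, u p) \<in> D}"
    show "(\<Sum>k\<in>UNIV - {j}. S p j k * ?f p k (u p $ j)) = 0"
    proof (rule theta_quot_relation_at_points[where S = "S p" and T = ?T,
          OF assms(1,3) distinct[OF p] sym])
      \<comment> \<open>The slice of \<open>D\<close> over the fixed value \<open>u p\<close> serves
        as the open set for analytic continuation in \<zeta>.\<close>
      have "open ((\<lambda>z. (z, u p)) -` D)"
        by (rule continuous_open_vimage[OF \<open>open D\<close>]) (intro continuous_intros)
      then show "open ?T" by (simp add: vimage_def)
      show "?T \<noteq> {}" using p assms(12) by (fastforce simp: image_subset_iff)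
      show "?E p z = 0" if "z \<in> ?T" for z
        using \<open>compatibility_condition F G H D W u\<close> p that unfolding compat by blast
    qed (use generic in auto)
  qed
  moreover have "compatibility_condition F G H D W u"
    if "2 * \<eta> \<notin> lattice \<tau>" "elliptic_system \<tau> \<eta> \<alpha> \<beta> \<gamma> W u"
    unfolding compat
  proof (intro ballI allI impI)
    fix p z assume p: "p \<in> W" and D: "(z, u p) \<in> D"
    show "?E p z = 0"
      by (rule theta_quot_relation_everywhere[OF assms(1,3) distinct[OF p] sym that(1) _ generic[OF D]])
        (use that(2) p in \<open>auto simp: elliptic\<close>)
  qed
  ultimately show ?thesis by blast
qed

end
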